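(* Let $1\le m<n$ be integers, let $f\in\mathbb{C}[z_1,\ldots,z_m]$ and $g\in\mathbb{C}[z_{m+1},\ldots,z_n]$ be polynomials with $f(0)=g(0)=0$, and regard $f$ and $g$ as polynomials in $\mathbb{C}[z_1,\ldots,z_n]$. Then, for $\varepsilon>0$ sufficiently small, the Milnor fibration product map $\Phi:S_\varepsilon\setminus K_{fg}\to T^2$ associated with $f$ and $g$ has no singular point.
   Context: $S_\varepsilon=\{z\in\mathbb{C}^n\mid \|z\|=\varepsilon\}$ and $K_{fg}=\{z\in S_\varepsilon\mid f(z)g(z)=0\}$. The Milnor fibration product map associated with $f,g$ is the $C^\infty$ map $\Phi:S_\varepsilon\setminus K_{fg}\to S^1\times S^1=T^2$, $\Phi(z)=\left(\frac{f(z)}{|f(z)|},\frac{g(z)}{|g(z)|}\right)$. A point $p$ is a singular point of $\Phi$ if $\mathrm{rank}\,d\Phi_p<2$. "For $\varepsilon>0$ sufficiently small" means: there is $\varepsilon_0>0$ (depending on $f,g$) such that the assertion holds for all $0<\varepsilon\le\varepsilon_0$. *)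

theory Defs
  imports "HOL-Analysis.Analysis" "HOL-Library.Poly_Mapping"
begin

text \<open>Complex polynomials in indeterminates \<open>z\<^sub>0, z\<^sub>1, z\<^sub>2, \<dots>\<close>: finitely supported
  maps from exponent vectors to coefficients. The polynomial ring over a set \<open>I\<close> of
  indeterminates consists of those \<open>p\<close> with \<open>indets p \<subseteq> I\<close>, so that the inclusion of
  polynomial rings for \<open>I \<subseteq> J\<close> is the identity.\<close>

type_synonym cpoly = "(nat \<Rightarrow>\<^sub>0 nat) \<Rightarrow>\<^sub>0 complex"

definition indets :: "cpoly \<Rightarrow> nat set" where
  "indets p = (\<Union>t\<in>Poly_Mapping.keys p. Poly_Mapping.keys t)"

definition eval_poly :: "cpoly \<Rightarrow> (nat \<Rightarrow> complex) \<Rightarrow> complex" where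
  "eval_poly p x = (\<Sum>t\<in>Poly_Mapping.keys p. Poly_Mapping.lookup p t *
     (\<Prod>i\<in>Poly_Mapping.keys t. x i ^ Poly_Mapping.lookup t i))"

text \<open>The map \<open>\<sigma>\<close> numbers the coordinates: the \<open>i\<close>-th coordinate of \<open>z\<close> is
  \<open>z $ \<sigma> i\<close>.\<close>

definition poly_fun :: "(nat \<Rightarrow> 'n) \<Rightarrow> cpoly \<Rightarrow> complex ^ 'n \<Rightarrow> complex" where
  "poly_fun \<sigma> p z = eval_poly p (\<lambda>i. z $ \<sigma> i)"

definition K_link :: "(complex ^ 'n \<Rightarrow> complex) \<Rightarrow> (complex ^ 'n \<Rightarrow> complex) \<Rightarrow> real
    \<Rightarrow> (complex ^ 'n) set" where
  "K_link f g \<epsilon> = {z \<in> sphere 0 \<epsilon>. f z * g z = 0}"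

definition milnor_product :: "(complex ^ 'n \<Rightarrow> complex) \<Rightarrow> (complex ^ 'n \<Rightarrow> complex)
    \<Rightarrow> complex ^ 'n \<Rightarrow> complex \<times> complex" where
  "milnor_product f g z =
     (f z / complex_of_real (cmod (f z)), g z / complex_of_real (cmod (g z)))"

text \<open>Tangent space of an embedded submanifold, as the set of velocities of curves in it.\<close>

definition tangent_space :: "'a::real_normed_vector set \<Rightarrow> 'a \<Rightarrow> 'a set" where
  "tangent_space M p = {v. \<exists>\<gamma> :: real \<Rightarrow> 'a. \<gamma> 0 = p \<and> (\<forall>\<^sub>F t in at 0. \<gamma> t \<in> M) \<and>
     (\<gamma> has_vector_derivative v) (at 0)}"

text \<open>Rank of the differential of \<open>F\<close> on a submanifold \<open>M\<close> at \<open>p\<close>. The derivative within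
  \<open>M\<close> is unique on tangent vectors only (lemma \<open>frechet_derivative_tangent\<close>), and only
  its restriction to the tangent space is used. Here \<^const>\<open>dim\<close> is the dimension over the
  reals; the rank is the same whether \<open>F\<close> is seen as a map to the ambient space or to a
  submanifold containing its image.\<close>

definition diff_rank :: "'a::euclidean_space set \<Rightarrow> ('a \<Rightarrow> 'b::euclidean_space) \<Rightarrow> 'a \<Rightarrow> nat"
  where "diff_rank M F p = dim (frechet_derivative F (at p within M) ` tangent_space M p)"

definition singular_point ::
    "'a::euclidean_space set \<Rightarrow> ('a \<Rightarrow> complex \<times> complex) \<Rightarrow> 'a \<Rightarrow> bool" where
  "singular_point M F p \<longleftrightarrow> p \<in> M \<and> diff_rank M F p < 2"

lemma has_derivative_tangent_unique:
  assumes D: "(F has_derivative D) (at p within M)" and E: "(F has_derivative E) (at p within M)"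
    and v: "v \<in> tangent_space M p" and p: "p \<in> M"
  shows "D v = E v"
proof -
  obtain \<gamma> :: "real \<Rightarrow> 'a" where \<gamma>: "\<gamma> 0 = p" "\<forall>\<^sub>F t in at 0. \<gamma> t \<in> M"
      "(\<gamma> has_vector_derivative v) (at 0)"
    using v by (auto simp: tangent_space_def)
  obtain d where d: "d > 0" "\<And>t. t \<noteq> 0 \<Longrightarrow> dist t 0 < d \<Longrightarrow> \<gamma> t \<in> M"
    using \<gamma>(2) by (auto simp: eventually_at)
  have sub: "\<gamma> ` ball 0 d \<subseteq> M"
  proof
    fix x assume "x \<in> \<gamma> ` ball 0 d"
    then obtain t where "x = \<gamma> t" "dist t 0 < d" by (auto simp: dist_commute)
    then show "x \<in> M" using d(2)[of t] \<gamma>(1) p by (cases "t = 0") auto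
  qed
  have at_eq: "at (0::real) within ball 0 d = at 0"
    using d(1) by (intro at_within_open) auto
  have comp: "((F \<circ> \<gamma>) has_vector_derivative H v) (at 0)"
    if "(F has_derivative H) (at p within M)" for H
  proof -
    have "(F has_derivative H) (at (\<gamma> 0) within \<gamma> ` ball 0 d)"
      using has_derivative_subset[OF that sub] \<gamma>(1) by simp
    moreover have "(\<gamma> has_vector_derivative v) (at 0 within ball 0 d)"
      using \<gamma>(3) at_eq by simp
    ultimately have "((F \<circ> \<gamma>) has_vector_derivative H v) (at 0 within ball 0 d)"
      by (metis vector_derivative_diff_chain_within)
    then show ?thesis using at_eq by simp
  qed
  show ?thesis
    using comp[OF D] comp[OF E] by (rule vector_derivative_unique_at)
qed

lemma frechet_derivative_tangent:
  assumes D: "(F has_derivative D) (at p within M)"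
    and v: "v \<in> tangent_space M p" and p: "p \<in> M"
  shows "frechet_derivative F (at p within M) v = D v"
proof -
  have "F differentiable (at p within M)"
    using D by (auto simp: differentiable_def)
  then have "(F has_derivative frechet_derivative F (at p within M)) (at p within M)"
    by (simp add: frechet_derivative_works)
  then show ?thesis
    using D v p by (rule has_derivative_tangent_unique)
qed

end

theory Submission
  imports "Jordan_Normal_Form.Char_Poly" Defs
begin

text \<open>Write \<open>p = (x, y)\<close> along the splitting of the variables. As \<open>f\<close> depends on \<open>x\<close> only and
  \<open>g\<close> on \<open>y\<close> only, it suffices that for each of the two polynomials the argument is a submersion
  on small spheres: a tangent vector in the \<open>x\<close>-directions moves \<open>arg f\<close> and leaves \<open>arg g\<close>
  fixed, and vice versa.

  For one polynomial this is Milnor's lemma. If it fails, points with \<open>grad arg f = \<lambda> z\<close> and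
  \<open>f \<noteq> 0\<close> accumulate at the origin, and they can be joined by a curve \<open>z(t)\<close>, \<open>\<bar>z(t)\<bar>\<^sup>2 = t\<close>,
  with real algebraic coordinates. Along it \<open>(arg f)' = \<lambda>/2\<close> has constant sign, and the
  Cauchy-Riemann equations together with \<open>\<bar>z\<^sub>j'\<bar> = O(t\<^sup>-\<^sup>1\<^sup>/\<^sup>2)\<close> bound \<open>(log \<bar>f\<bar>)'\<close> by a constant
  multiple of \<open>\<bar>(arg f)'\<bar>\<close>. Since \<open>arg f\<close> stays bounded, so does \<open>log \<bar>f\<bar>\<close>, contradicting
  \<open>f(z(t)) \<rightarrow> 0\<close>.

  The curve is found without semialgebraic geometry. The system is written as \<open>Q(t, x) = 0\<close> with
  \<open>Q \<ge> 0\<close>; the critical points of the penalty functional \<open>s Q(t, \<cdot>) + \<Sum> x\<^sub>i\<^sup>E\<close>, \<open>E > deg Q\<close>, have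
  coordinates integral over \<open>\<real>[s, t]\<close>, so that the limits of its minimisers for \<open>s \<rightarrow> \<infinity>\<close> are
  solutions with coordinates algebraic over \<open>\<real>(t)\<close>, with equations independent of \<open>t\<close>. A polynomial
  expression in continuous algebraic functions has a constant sign near \<open>0\<close>, so that solutions at a
  sequence of parameters extend to a solution on an interval.\<close>

section \<open>Annihilating polynomials\<close>

text \<open>The determinant trick: the relations say that the values \<open>v \<beta> z\<close> form
  an eigenvector, with eigenvalue \<open>e z\<close>, of the matrix \<open>a\<close> specialised by
  \<open>h z\<close>. The characteristic polynomial is formed over \<open>'r\<close> before
  specialising, so one monic polynomial serves all \<open>z\<close>.\<close>

lemma annihilating_poly_of_matrix:
  fixes h :: "'z \<Rightarrow> 'r::comm_ring_1 \<Rightarrow> real" and v :: "'b \<Rightarrow> 'z \<Rightarrow> real" and e :: "'z \<Rightarrow> real"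
  assumes fin: "finite B" and hom: "\<And>z. comm_ring_hom (h z)"
    and rel: "\<And>\<beta> z. \<beta> \<in> B \<Longrightarrow> z \<in> Z \<Longrightarrow> e z * v \<beta> z = (\<Sum>\<gamma>\<in>B. h z (a \<beta> \<gamma>) * v \<gamma> z)"
    and nz: "\<And>z. z \<in> Z \<Longrightarrow> \<exists>\<beta>\<in>B. v \<beta> z \<noteq> 0"
  obtains P :: "'r poly" where "lead_coeff P = 1" "\<And>z. z \<in> Z \<Longrightarrow> poly (map_poly (h z) P) (e z) = 0"
proof -
  define M where "M = card B"
  obtain g where g: "bij_betw g {..<M} B"
    using ex_bij_betw_nat_finite[OF fin] unfolding M_def atLeast0LessThan by blast
  define A where "A = Matrix.mat M M (\<lambda>(i,j). a (g i) (g j))"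
  have A: "A \<in> carrier_mat M M" by (simp add: A_def)
  show thesis
  proof (rule that[of "char_poly A"])
    show "lead_coeff (char_poly A) = 1" using degree_monic_char_poly[OF A] by simp
  next
    fix z assume z: "z \<in> Z"
    define w where "w = Matrix.vec M (\<lambda>j. v (g j) z)"
    obtain \<beta> where \<beta>: "\<beta> \<in> B" "v \<beta> z \<noteq> 0" using nz[OF z] by blast
    then obtain j where j: "j < M" "g j = \<beta>" using g by (auto simp: bij_betw_def)
    have w: "w \<in> carrier_vec M" "w \<noteq> 0\<^sub>v M"
    proof -
      have "vec_index w j \<noteq> vec_index (0\<^sub>v M) j" using j \<beta> by (simp add: w_def)
      then show "w \<noteq> 0\<^sub>v M" by metis
    qed (simp add: w_def)
    have "map_mat (h z) A *\<^sub>v w = e z \<cdot>\<^sub>v w"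
    proof (rule eq_vecI)
      fix i assume "i < dim_vec (e z \<cdot>\<^sub>v w)"
      then have i: "i < M" by (simp add: w_def)
      then have gi: "g i \<in> B" using g by (auto simp: bij_betw_def)
      have "vec_index (map_mat (h z) A *\<^sub>v w) i = (\<Sum>j<M. h z (a (g i) (g j)) * v (g j) z)"
        using i by (simp add: w_def A_def scalar_prod_def atLeast0LessThan)
      also have "\<dots> = (\<Sum>\<gamma>\<in>B. h z (a (g i) \<gamma>) * v \<gamma> z)"
        by (rule sum.reindex_bij_betw[OF g])
      also have "\<dots> = e z * v (g i) z" using rel[OF gi z] by simp
      finally show "vec_index (map_mat (h z) A *\<^sub>v w) i = vec_index (e z \<cdot>\<^sub>v w) i"
        using i by (simp add: w_def)
    qed (simp add: w_def A_def)
    then have "eigenvalue (map_mat (h z) A) (e z)"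
      unfolding eigenvalue_def eigenvector_def using w A by auto
    then have "poly (char_poly (map_mat (h z) A)) (e z) = 0"
      using eigenvalue_root_char_poly[of "map_mat (h z) A" M] A by simp
    then show "poly (map_poly (h z) (char_poly A)) (e z) = 0"
      using comm_ring_hom.char_poly_hom[OF hom A] by metis
  qed
qed

section \<open>Monomials and integral dependence\<close>

definition power_prod :: "('i::finite \<Rightarrow> nat) \<Rightarrow> ('i \<Rightarrow> 'a::comm_ring_1) \<Rightarrow> 'a" where
  "power_prod \<alpha> x = (\<Prod>i\<in>UNIV. x i ^ \<alpha> i)"

lemma power_prod_zero [simp]: "power_prod (\<lambda>_. 0) x = 1"
  by (simp add: power_prod_def)

lemma power_prod_add: "power_prod (\<lambda>i. \<alpha> i + \<beta> i) x = power_prod \<alpha> x * power_prod \<beta> x"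
  by (simp add: power_prod_def power_add prod.distrib)

lemma power_prod_single: "power_prod (\<lambda>j. if j = i then k else 0) x = x i ^ k"
proof -
  have "power_prod (\<lambda>j. if j = i then k else 0) x = (\<Prod>j\<in>UNIV. if j = i then x j ^ k else 1)"
    unfolding power_prod_def by (rule prod.cong) auto
  then show ?thesis by simp
qed

text \<open>The reductions of the powers \<open>X z i ^ D\<close> lower the total degree, so by
  induction every monomial is a combination of those with all exponents below \<open>D\<close>.
  Multiplication by \<open>e\<close> therefore acts on this finite family by a matrix over
  \<open>'r\<close>.\<close>

lemma annihilating_poly_of_integral:
  fixes h :: "'z \<Rightarrow> 'r::comm_ring_1 \<Rightarrow> real" and X :: "'z \<Rightarrow> 'i::finite \<Rightarrow> real" and e :: "'z \<Rightarrow> real"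
  assumes hom: "\<And>z. comm_ring_hom (h z)" and D: "D > 0"
    and red: "\<And>i. \<exists>l. (\<forall>(c,\<alpha>)\<in>set l. sum \<alpha> UNIV < D) \<and>
      (\<forall>z\<in>Z. X z i ^ D = (\<Sum>(c,\<alpha>)\<leftarrow>l. h z c * power_prod \<alpha> (X z)))"
    and e: "\<And>z. z \<in> Z \<Longrightarrow> e z = (\<Sum>(c,\<alpha>)\<leftarrow>l. h z c * power_prod \<alpha> (X z))"
  obtains P :: "'r poly" where "lead_coeff P = 1" "\<And>z. z \<in> Z \<Longrightarrow> poly (map_poly (h z) P) (e z) = 0"
proof -
  interpret comm_ring_hom "h z" for z by (rule hom)
  define B where "B = {\<alpha>::'i \<Rightarrow> nat. \<forall>i. \<alpha> i < D}"
  have finB: "finite B"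
  proof -
    have "B = PiE UNIV (\<lambda>_. {..<D})" by (auto simp: B_def PiE_def Pi_def)
    then show ?thesis by (simp add: finite_PiE)
  qed
  \<comment> \<open>The functions that agree on \<open>Z\<close> with a combination of the monomials
    in \<open>B\<close>; the coefficients in \<open>'r\<close> are the same for all
    \<open>z\<close>.\<close>
  define W where "W = {F. \<exists>c. \<forall>z\<in>Z. F z = (\<Sum>\<beta>\<in>B. h z (c \<beta>) * power_prod \<beta> (X z))}"
  have W_cong: "F \<in> W" if "G \<in> W" "\<And>z. z \<in> Z \<Longrightarrow> F z = G z" for F G
    using that by (auto simp: W_def)
  have W_zero: "(\<lambda>_. 0) \<in> W" unfolding W_def by (auto intro!: exI[of _ "\<lambda>_. 0"])
  have W_add: "(\<lambda>z. F z + G z) \<in> W" if F: "F \<in> W" and G: "G \<in> W" for F G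
  proof -
    obtain c d where c: "\<forall>z\<in>Z. F z = (\<Sum>\<beta>\<in>B. h z (c \<beta>) * power_prod \<beta> (X z))"
      and d: "\<forall>z\<in>Z. G z = (\<Sum>\<beta>\<in>B. h z (d \<beta>) * power_prod \<beta> (X z))"
      using F G unfolding W_def by auto
    show ?thesis unfolding W_def
      by (rule CollectI, rule exI[of _ "\<lambda>\<beta>. c \<beta> + d \<beta>"])
        (simp add: c d sum.distrib hom_add distrib_right)
  qed
  have W_scale: "(\<lambda>z. h z r * F z) \<in> W" if F: "F \<in> W" for F r
  proof -
    obtain c where c: "\<forall>z\<in>Z. F z = (\<Sum>\<beta>\<in>B. h z (c \<beta>) * power_prod \<beta> (X z))"
      using F unfolding W_def by auto
    show ?thesis unfolding W_def
      by (rule CollectI, rule exI[of _ "\<lambda>\<beta>. r * c \<beta>"])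
        (simp add: c sum_distrib_left hom_mult mult.assoc)
  qed
  have W_list: "(\<lambda>z. \<Sum>(c,\<alpha>)\<leftarrow>l. h z c * G \<alpha> z) \<in> W"
    if "\<And>c \<alpha>. (c,\<alpha>) \<in> set l \<Longrightarrow> G \<alpha> \<in> W" for l and G :: "('i \<Rightarrow> nat) \<Rightarrow> 'z \<Rightarrow> real"
    using that
  proof (induction l)
    case Nil then show ?case using W_zero by simp
  next
    case (Cons p l)
    obtain c \<alpha> where p: "p = (c, \<alpha>)" by (cases p)
    show ?case using W_add[OF W_scale[of "G \<alpha>" c] Cons.IH] Cons.prems by (auto simp: p)
  qed
  have W_mono: "(\<lambda>z. power_prod \<alpha> (X z)) \<in> W" for \<alpha>
  proof (induction "sum \<alpha> UNIV" arbitrary: \<alpha> rule: less_induct)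
    case less
    show ?case
    proof (cases "\<alpha> \<in> B")
      case True
      have "(\<Sum>\<beta>\<in>B. h z (if \<beta> = \<alpha> then 1 else 0) * power_prod \<beta> (X z)) = power_prod \<alpha> (X z)" for z
      proof -
        have "(\<Sum>\<beta>\<in>B. h z (if \<beta> = \<alpha> then 1 else 0) * power_prod \<beta> (X z))
            = (\<Sum>\<beta>\<in>B. if \<beta> = \<alpha> then power_prod \<beta> (X z) else 0)"
          by (rule sum.cong) auto
        then show ?thesis using True finB by simp
      qed
      then show ?thesis unfolding W_def by (intro CollectI exI[of _ "\<lambda>\<beta>. if \<beta> = \<alpha> then 1 else 0"]) simp
    next
      case False
      then obtain i where i: "\<alpha> i \<ge> D" by (auto simp: B_def not_less)
      \<comment> \<open>Splitting off \<open>X z i ^ D\<close> and inserting its reduction leaves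
        monomials of smaller total degree, to which the induction hypothesis applies.\<close>
      define \<beta> where "\<beta> = \<alpha>(i := \<alpha> i - D)"
      have \<alpha>: "\<alpha> = (\<lambda>j. \<beta> j + (if j = i then D else 0))" using i by (auto simp: \<beta>_def)
      have s: "sum \<alpha> UNIV = sum \<beta> UNIV + D" by (subst \<alpha>) (simp add: sum.distrib)
      obtain l where l: "\<forall>(c,\<gamma>)\<in>set l. sum \<gamma> UNIV < D"
        "\<forall>z\<in>Z. X z i ^ D = (\<Sum>(c,\<gamma>)\<leftarrow>l. h z c * power_prod \<gamma> (X z))"
        using red[of i] by blast
      have "(\<lambda>z. \<Sum>(c,\<gamma>)\<leftarrow>l. h z c * power_prod (\<lambda>j. \<gamma> j + \<beta> j) (X z)) \<in> W"
      proof (rule W_list)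
        fix c \<gamma> assume "(c,\<gamma>) \<in> set l"
        then have "sum \<gamma> UNIV < D" using l(1) by auto
        then have "sum (\<lambda>j. \<gamma> j + \<beta> j) UNIV < sum \<alpha> UNIV" by (simp add: s sum.distrib)
        then show "(\<lambda>z. power_prod (\<lambda>j. \<gamma> j + \<beta> j) (X z)) \<in> W" by (rule less)
      qed
      then show ?thesis
      proof (rule W_cong)
        fix z assume z: "z \<in> Z"
        have "power_prod \<alpha> (X z) = X z i ^ D * power_prod \<beta> (X z)"
          by (subst \<alpha>) (simp only: power_prod_add power_prod_single mult.commute)
        also have "\<dots> = (\<Sum>(c,\<gamma>)\<leftarrow>l. h z c * power_prod \<gamma> (X z)) * power_prod \<beta> (X z)"
          using l(2) z by simp
        also have "\<dots> = (\<Sum>(c,\<gamma>)\<leftarrow>l. h z c * power_prod (\<lambda>j. \<gamma> j + \<beta> j) (X z))"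
          by (simp add: sum_list_mult_const[symmetric] case_prod_unfold power_prod_add mult.assoc)
        finally show "power_prod \<alpha> (X z) = (\<Sum>(c,\<gamma>)\<leftarrow>l. h z c * power_prod (\<lambda>j. \<gamma> j + \<beta> j) (X z))" .
      qed
    qed
  qed
  have "(\<lambda>z. e z * power_prod \<beta> (X z)) \<in> W" for \<beta>
  proof -
    have "(\<lambda>z. \<Sum>(c,\<gamma>)\<leftarrow>l. h z c * power_prod (\<lambda>j. \<gamma> j + \<beta> j) (X z)) \<in> W"
      by (rule W_list) (rule W_mono)
    then show ?thesis
      by (rule W_cong)
        (simp add: e sum_list_mult_const[symmetric] case_prod_unfold power_prod_add mult.assoc)
  qed
  then have "\<exists>c. \<forall>z\<in>Z. e z * power_prod \<beta> (X z) = (\<Sum>\<gamma>\<in>B. h z (c \<gamma>) * power_prod \<gamma> (X z))" for \<beta>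
    unfolding W_def by auto
  then obtain a where a: "\<And>\<beta> z. z \<in> Z \<Longrightarrow>
      e z * power_prod \<beta> (X z) = (\<Sum>\<gamma>\<in>B. h z (a \<beta> \<gamma>) * power_prod \<gamma> (X z))"
    by metis
  show thesis
  proof (rule annihilating_poly_of_matrix[of B h Z e "\<lambda>\<beta> z. power_prod \<beta> (X z)" a, OF finB hom a])
    fix z
    \<comment> \<open>The monomial 1 lies in \<open>B\<close> and keeps the eigenvector
      nonzero.\<close>
    have "(\<lambda>_. 0) \<in> B" using D by (simp add: B_def)
    then show "\<exists>\<beta>\<in>B. power_prod \<beta> (X z) \<noteq> 0" by (intro bexI[of _ "\<lambda>_. 0"]) auto
  qed (auto intro: that)
qed

section \<open>Polynomial functions with a parameter\<close>

text \<open>A polynomial in \<open>x\<close> over \<open>\<real>[t]\<close> is evaluated by first substituting a constant polynomial.\<close>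

abbreviation eval2 :: "real poly poly \<Rightarrow> real \<Rightarrow> real \<Rightarrow> real" where
  "eval2 p t x \<equiv> poly (poly p [:x:]) t"

lemma poly_poly_eq: "poly (poly p a) t = poly (map_poly (\<lambda>c. poly c t) p) (poly a (t::'a::comm_ring_1))"
  by (induction p) (simp_all add: map_poly_pCons)

lemma poly_poly_const: "poly (poly p [:x:]) t = poly (map_poly (\<lambda>c. poly c t) p) (x::'a::comm_ring_1)"
  by (simp add: poly_poly_eq)

lemma eval2_altdef: "eval2 p t x = (\<Sum>k\<le>degree p. poly (coeff p k) t * x ^ k)"
  by (subst poly_altdef[of p]) (simp add: poly_sum)

lemma continuous_eval2:
  assumes "continuous_on S f" "continuous_on S g"
  shows "continuous_on S (\<lambda>z. eval2 p (f z) (g z))"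
proof (induction p)
  case (pCons a p)
  have "continuous_on S (\<lambda>z. poly a (f z) + g z * eval2 p (f z) (g z))"
    by (intro continuous_on_add continuous_on_mult pCons.IH assms
        continuous_on_compose2[OF continuous_on_poly[OF continuous_on_id, of UNIV a] assms(1)]) auto
  then show ?case by simp
qed simp

lemma poly_nonzero_near_0:
  fixes c :: "real poly"
  assumes "c \<noteq> 0"
  obtains d where "d > 0" "\<And>t. 0 < t \<Longrightarrow> t < d \<Longrightarrow> poly c t \<noteq> 0"
proof -
  have "finite {t. poly c t = 0}" using assms by (rule poly_roots_finite)
  then have "\<exists>d>0. \<forall>x\<in>{t. poly c t = 0}. x \<noteq> 0 \<longrightarrow> d \<le> dist 0 x"
    by (rule finite_set_avoid)
  then obtain d where d: "d > 0" "\<And>x. poly c x = 0 \<Longrightarrow> x \<noteq> 0 \<Longrightarrow> d \<le> dist 0 x" by auto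
  show thesis
  proof (rule that[OF d(1)])
    fix t assume "0 < t" "t < d"
    then show "poly c t \<noteq> 0" using d(2)[of t] by (auto simp: dist_real_def)
  qed
qed

text \<open>Closure rules on functions make closure properties a matter of induction; degrees and
  partial derivatives are read off the expansion \<open>monomial_sum\<close>, which represents every
  member.\<close>

inductive polyfun :: "(real \<Rightarrow> ('i::finite \<Rightarrow> real) \<Rightarrow> real) \<Rightarrow> bool" where
  const: "polyfun (\<lambda>t x. c)"
| param: "polyfun (\<lambda>t x. t)"
| coord: "polyfun (\<lambda>t x. x i)"
| add: "polyfun F \<Longrightarrow> polyfun G \<Longrightarrow> polyfun (\<lambda>t x. F t x + G t x)"
| mult: "polyfun F \<Longrightarrow> polyfun G \<Longrightarrow> polyfun (\<lambda>t x. F t x * G t x)"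

lemma polyfun_minus: "polyfun F \<Longrightarrow> polyfun (\<lambda>t x. - F t x)"
  using polyfun.mult[OF polyfun.const[of "-1"], of F] by simp

lemma polyfun_diff: "polyfun F \<Longrightarrow> polyfun G \<Longrightarrow> polyfun (\<lambda>t x. F t x - G t x)"
  using polyfun.add[OF _ polyfun_minus, of F G] by simp

lemma polyfun_power: "polyfun F \<Longrightarrow> polyfun (\<lambda>t x. F t x ^ k)"
  by (induction k) (simp_all add: polyfun.const polyfun.mult)

lemma polyfun_sum:
  "(\<And>a. a \<in> A \<Longrightarrow> polyfun (F a)) \<Longrightarrow> polyfun (\<lambda>t x. \<Sum>a\<in>A. F a t x)"
  by (induction A rule: infinite_finite_induct) (simp_all add: polyfun.const polyfun.add)

lemma polyfun_poly: "polyfun F \<Longrightarrow> polyfun (\<lambda>t x. poly c (F t x))"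
  by (induction c) (simp_all add: polyfun.const polyfun.add polyfun.mult)

lemma polyfun_eval2: "polyfun F \<Longrightarrow> polyfun G \<Longrightarrow> polyfun (\<lambda>t x. eval2 p (F t x) (G t x))"
  by (induction p) (simp_all add: polyfun.const polyfun.add polyfun.mult polyfun_poly)

lemma polyfun_continuous_on:
  assumes "polyfun F" "\<And>i. continuous_on S (\<lambda>z. X z i)" "continuous_on S f"
  shows "continuous_on S (\<lambda>z. F (f z) (X z))"
  using assms(1)
proof induction
  case (add F G) show ?case by (rule continuous_on_add[OF add.IH])
next
  case (mult F G) show ?case by (rule continuous_on_mult[OF mult.IH])
qed (simp_all add: assms(2,3))

definition monomial_sum ::
    "(real poly \<times> ('i::finite \<Rightarrow> nat)) list \<Rightarrow> real \<Rightarrow> ('i \<Rightarrow> real) \<Rightarrow> real" where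
  "monomial_sum l t x = (\<Sum>(c,\<alpha>)\<leftarrow>l. poly c t * power_prod \<alpha> x)"

lemma monomial_sum_Nil [simp]: "monomial_sum [] t x = 0"
  and monomial_sum_Cons [simp]:
    "monomial_sum ((c,\<alpha>) # l) t x = poly c t * power_prod \<alpha> x + monomial_sum l t x"
  and monomial_sum_append [simp]:
    "monomial_sum (l @ l') t x = monomial_sum l t x + monomial_sum l' t x"
  by (simp_all add: monomial_sum_def)

lemma polyfun_monomial_sum:
  assumes "polyfun F" obtains l where "F = monomial_sum l"
proof -
  have "\<exists>l. F = monomial_sum l" using assms
  proof induction
    case (const c)
    show ?case by (rule exI[of _ "[([:c:], \<lambda>_. 0)]"]) (simp add: fun_eq_iff)
  next
    case param
    show ?case by (rule exI[of _ "[([:0, 1:], \<lambda>_. 0)]"]) (simp add: fun_eq_iff)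
  next
    case (coord i)
    show ?case by (rule exI[of _ "[(1, \<lambda>j. if j = i then 1 else 0)]"])
        (simp add: fun_eq_iff power_prod_single)
  next
    case (add F G)
    then obtain l l' where "F = monomial_sum l" "G = monomial_sum l'" by blast
    then show ?case by (intro exI[of _ "l @ l'"]) (simp add: fun_eq_iff)
  next
    case (mult F G)
    then obtain l l' where l: "F = monomial_sum l" "G = monomial_sum l'" by blast
    have mono_mult: "\<exists>k. \<forall>t x. monomial_sum k t x = poly c t * power_prod \<alpha> x * monomial_sum l' t x"
      for c and \<alpha> :: "'a \<Rightarrow> nat"
    proof (induction l')
      case Nil then show ?case by (intro exI[of _ "[]"]) simp
    next
      case (Cons p l')
      obtain d \<beta> where p: "p = (d, \<beta>)" by (cases p)
      obtain k where k: "\<forall>t x. monomial_sum k t x = poly c t * power_prod \<alpha> x * monomial_sum l' t x"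
        using Cons by blast
      show ?case by (rule exI[of _ "(c * d, \<lambda>i. \<alpha> i + \<beta> i) # k"])
          (simp add: p k power_prod_add algebra_simps)
    qed
    have "\<exists>k. \<forall>t x. monomial_sum k t x = monomial_sum l t x * monomial_sum l' t x"
    proof (induction l)
      case Nil then show ?case by (intro exI[of _ "[]"]) simp
    next
      case (Cons p l)
      obtain c \<alpha> where p: "p = (c, \<alpha>)" by (cases p)
      obtain k where k: "\<forall>t x. monomial_sum k t x = monomial_sum l t x * monomial_sum l' t x"
        using Cons by blast
      obtain k' where k': "\<forall>t x. monomial_sum k' t x = poly c t * power_prod \<alpha> x * monomial_sum l' t x"
        using mono_mult by blast
      show ?case by (rule exI[of _ "k' @ k"]) (simp add: p k k' algebra_simps)
    qed
    then show ?case by (auto simp: l fun_eq_iff) metis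
  qed
  then show thesis using that by blast
qed

lemma power_prod_scale: "power_prod \<alpha> (\<lambda>i. c * x i) = c ^ sum \<alpha> UNIV * power_prod \<alpha> x"
  by (simp add: power_prod_def power_mult_distrib prod.distrib power_sum)

section \<open>Polynomial expressions in algebraic functions: algebraicity and constant sign\<close>

text \<open>Once the \<open>p i\<close> are brought to a common degree \<open>D\<close> and leading
  coefficient \<open>C\<close>, the functions C X_i are integral over \<real>[t]. A power of
  \<open>C\<close> times \<open>F t (X t)\<close> is a polynomial in them, hence integral, and
  substituting this multiple into its monic equation yields \<open>q\<close>. Nothing is divided by
  \<open>C\<close>, so its zeros do no harm.\<close>

lemma polyfun_algebraic:
  fixes X :: "real \<Rightarrow> 'i::finite \<Rightarrow> real" and p :: "'i \<Rightarrow> real poly poly"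
  assumes deg: "\<And>i. degree (p i) > 0"
    and root: "\<And>t i. t \<in> Z \<Longrightarrow> eval2 (p i) t (X t i) = 0"
    and F: "polyfun F"
  obtains q where "q \<noteq> 0" "\<And>t. t \<in> Z \<Longrightarrow> eval2 q t (F t (X t)) = 0"
proof -
  define D where "D = (\<Sum>i\<in>UNIV. degree (p i))"
  define C where "C = (\<Prod>i\<in>UNIV. lead_coeff (p i))"
  \<comment> \<open>Multiplying \<open>p i\<close> by a power of the variable and by the other
    leading coefficients gives every \<open>r i\<close> degree \<open>D\<close> and leading
    coefficient \<open>C\<close>.\<close>
  define r where "r i = Polynomial.smult (\<Prod>j\<in>UNIV-{i}. lead_coeff (p j)) (p i * Polynomial.monom 1 (D - degree (p i)))" for i
  have p0: "p i \<noteq> 0" for i using deg[of i] by auto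
  have C0: "C \<noteq> 0" using p0 by (simp add: C_def)
  have le: "degree (p i) \<le> D" for i unfolding D_def by (rule member_le_sum) auto
  have D0: "D > 0" using deg[of undefined] le[of undefined] by linarith
  have C_split: "C = (\<Prod>j\<in>UNIV-{i}. lead_coeff (p j)) * lead_coeff (p i)" for i
    unfolding C_def by (subst prod.remove[of UNIV i]) (auto simp: mult.commute)
  have ne: "(\<Prod>j\<in>UNIV-{i}. lead_coeff (p j)) \<noteq> 0" for i using p0 by simp
  have monom: "degree (Polynomial.monom (1 :: real poly) k) = k" for k
    by (rule Polynomial.degree_monom_eq) simp
  have degr: "degree (r i) = D" for i
  proof -
    have "degree (r i) = degree (p i * Polynomial.monom 1 (D - degree (p i)))"
      unfolding r_def using ne[of i] by (rule degree_smult_eq[THEN trans, OF if_not_P])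
    also have "\<dots> = degree (p i) + (D - degree (p i))"
      by (subst degree_mult_eq) (use p0[of i] in \<open>simp_all add: monom monom_eq_0_iff\<close>)
    finally show ?thesis using le[of i] by simp
  qed
  have lcr: "coeff (r i) D = C" for i
  proof -
    have "lead_coeff (r i) = C" unfolding r_def C_split[of i]
      by (simp add: lead_coeff_mult monom)
    then show ?thesis by (simp add: degr)
  qed
  define Y where "Y t i = poly C t * X t i" for t i
  have Y: "Y t = (\<lambda>i. poly C t * X t i)" for t by (simp add: Y_def fun_eq_iff)
  have rel: "Y t i ^ D = (\<Sum>k<D. poly (- coeff (r i) k * C ^ (D - 1 - k)) t * Y t i ^ k)"
    if t: "t \<in> Z" for t i
  proof -
    have "eval2 (r i) t (X t i) = 0" using root[OF t] by (simp add: r_def)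
    then have "(\<Sum>k\<le>D. poly (coeff (r i) k) t * X t i ^ k) = 0"
      by (simp add: eval2_altdef degr)
    then have s: "(\<Sum>k<D. poly (coeff (r i) k) t * X t i ^ k) + poly C t * X t i ^ D = 0"
      by (simp add: lessThan_Suc_atMost[symmetric] lcr)
    have "(\<Sum>k<D. poly (- coeff (r i) k * C ^ (D - 1 - k)) t * Y t i ^ k)
        = - (poly C t ^ (D - 1) * (\<Sum>k<D. poly (coeff (r i) k) t * X t i ^ k))"
      unfolding sum_distrib_left sum_negf[symmetric]
    proof (rule sum.cong)
      fix k assume "k \<in> {..<D}"
      then have "poly C t ^ (D - 1) = poly C t ^ (D - 1 - k) * poly C t ^ k"
        by (simp add: power_add[symmetric])
      then show "poly (- coeff (r i) k * C ^ (D - 1 - k)) t * Y t i ^ k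
          = - (poly C t ^ (D - 1) * (poly (coeff (r i) k) t * X t i ^ k))"
        by (simp add: Y_def power_mult_distrib)
    qed simp
    also have "\<dots> = poly C t ^ (D - 1) * (poly C t * X t i ^ D)"
    proof -
      have e: "(\<Sum>k<D. poly (coeff (r i) k) t * X t i ^ k) = - (poly C t * X t i ^ D)"
        using s by linarith
      show ?thesis unfolding e by simp
    qed
    also have "\<dots> = (poly C t ^ (D - 1) * poly C t) * X t i ^ D" by simp
    also have "poly C t ^ (D - 1) * poly C t = poly C t ^ D"
      using D0 by (simp add: power_Suc2[symmetric] del: power_Suc)
    finally show ?thesis by (simp add: Y_def power_mult_distrib)
  qed
  obtain l where l: "F = monomial_sum l" using polyfun_monomial_sum[OF F] by blast
  define K where "K = (\<Sum>(c,\<alpha>)\<leftarrow>l. sum \<alpha> UNIV)"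
  have K: "sum \<alpha> UNIV \<le> K" if "(c,\<alpha>) \<in> set l" for c \<alpha>
    unfolding K_def using that by (intro member_le_sum_list) force+
  \<comment> \<open>A monomial of total degree k absorbs C^k when X is replaced by Y = C X; since
    \<open>K\<close> bounds all degrees, the remaining power of \<open>C\<close> can go into the
    coefficient.\<close>
  define l' where "l' = map (\<lambda>(c,\<alpha>). (c * C ^ (K - sum \<alpha> UNIV), \<alpha>)) l"
  have e: "poly C t ^ K * F t (X t) = (\<Sum>(c,\<alpha>)\<leftarrow>l'. poly c t * power_prod \<alpha> (Y t))" for t
  proof -
    have "poly C t ^ K * F t (X t) = (\<Sum>(c,\<alpha>)\<leftarrow>l. poly C t ^ K * (poly c t * power_prod \<alpha> (X t)))"
      unfolding l monomial_sum_def by (simp add: sum_list_const_mult[symmetric] case_prod_unfold)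
    also have "\<dots> = (\<Sum>(c,\<alpha>)\<leftarrow>l. poly (c * C ^ (K - sum \<alpha> UNIV)) t * power_prod \<alpha> (Y t))"
    proof (rule arg_cong[where f = sum_list], rule map_cong[OF refl], clarify)
      fix c \<alpha> assume "(c,\<alpha>) \<in> set l"
      then have "poly C t ^ K = poly C t ^ (K - sum \<alpha> UNIV) * poly C t ^ sum \<alpha> UNIV"
        using K by (simp add: power_add[symmetric])
      then show "poly C t ^ K * (poly c t * power_prod \<alpha> (X t))
          = poly (c * C ^ (K - sum \<alpha> UNIV)) t * power_prod \<alpha> (Y t)"
        by (simp add: Y power_prod_scale)
    qed
    also have "\<dots> = (\<Sum>(c,\<alpha>)\<leftarrow>l'. poly c t * power_prod \<alpha> (Y t))"
      by (simp add: l'_def case_prod_unfold comp_def)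
    finally show ?thesis .
  qed
  have hom: "comm_ring_hom (\<lambda>c. poly c t)" for t :: real by (rule poly_hom.comm_ring_hom_axioms)
  have "\<exists>l. (\<forall>(c,\<alpha>)\<in>set l. sum \<alpha> UNIV < D) \<and>
      (\<forall>t\<in>Z. Y t i ^ D = (\<Sum>(c,\<alpha>)\<leftarrow>l. poly c t * power_prod \<alpha> (Y t)))" for i
    by (rule exI[of _ "map (\<lambda>k. (- coeff (r i) k * C ^ (D - 1 - k), \<lambda>j. if j = i then k else 0)) [0..<D]"])
      (auto simp: rel comp_def power_prod_single interv_sum_list_conv_sum_set_nat atLeast0LessThan
        simp del: poly_mult)
  then obtain P :: "real poly poly" where P: "lead_coeff P = 1"
      "\<And>t. t \<in> Z \<Longrightarrow> poly (map_poly (\<lambda>c. poly c t) P) (poly C t ^ K * F t (X t)) = 0"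
    by (rule annihilating_poly_of_integral[of "\<lambda>t c. poly c t" D Z Y _ l', OF hom D0 _ e]) blast
  show thesis
  proof (rule that[of "pcompose P [:0, C ^ K:]"])
    show "pcompose P [:0, C ^ K:] \<noteq> 0"
      using P(1) C0 by (metis degree_pCons_eq_if leading_coeff_0_iff pCons_eq_0_iff pcompose_eq_0
          power_not_zero zero_less_Suc zero_neq_one)
    fix t assume "t \<in> Z"
    then show "eval2 (pcompose P [:0, C ^ K:]) t (F t (X t)) = 0"
      using P(2)[of t] by (simp add: poly_pcompose poly_poly_eq mult.commute)
  qed
qed

text \<open>Write q = y^k q1 with q1(t, 0) not identically zero. Near 0 the zeros of
  \<open>g\<close> and those of q1(t, g(t)) are disjoint closed sets covering an interval, so by
  connectedness one of them is empty: \<open>g\<close> vanishes identically or nowhere, and in the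
  second case it has one sign.\<close>

lemma algebraic_eventual_sign:
  assumes q: "q \<noteq> 0" and d: "d > 0" and g: "continuous_on {0<..<d} g"
    and root: "\<And>t. t \<in> {0<..<d} \<Longrightarrow> eval2 q t (g t) = 0"
  obtains d' where "0 < d'" "d' \<le> d"
    "(\<forall>t\<in>{0<..<d'}. g t = 0) \<or> (\<forall>t\<in>{0<..<d'}. g t > 0) \<or> (\<forall>t\<in>{0<..<d'}. g t < 0)"
proof -
  obtain q1 where q1: "q = [:0, 1:] ^ order 0 q * q1" "\<not> [:0, 1:] dvd q1"
    using order_decomp[OF q, of 0] by auto
  have c0: "poly q1 0 \<noteq> 0" using q1(2) by (simp add: poly_eq_0_iff_dvd)
  then obtain d1 where d1: "d1 > 0" "\<And>t. 0 < t \<Longrightarrow> t < d1 \<Longrightarrow> poly (poly q1 0) t \<noteq> 0"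
    using poly_nonzero_near_0 by blast
  define d' where "d' = min d d1"
  have d': "0 < d'" "d' \<le> d" using d d1 by (auto simp: d'_def)
  define I where "I = {0<..<d'}"
  have gI: "continuous_on I g" by (rule continuous_on_subset[OF g]) (use d' in \<open>auto simp: I_def\<close>)
  have conn: "connected I" by (simp add: I_def)
  define A where "A = {t\<in>I. g t = 0}"
  define B where "B = {t\<in>I. eval2 q1 t (g t) = 0}"
  have "closedin (top_of_set I) A" unfolding A_def
    by (rule continuous_closedin_preimage_constant[OF gI])
  moreover have "closedin (top_of_set I) B" unfolding B_def
    by (rule continuous_closedin_preimage_constant) (intro continuous_eval2 gI continuous_intros)
  moreover have "I \<subseteq> A \<union> B"
  proof
    fix t assume t: "t \<in> I"
    then have "eval2 q t (g t) = 0" using root d' by (auto simp: I_def)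
    then have "g t ^ order 0 q * eval2 q1 t (g t) = 0"
      by (subst (asm) q1(1)) (simp add: poly_power)
    then show "t \<in> A \<union> B" using t by (auto simp: A_def B_def)
  qed
  moreover have "A \<inter> B = {}" using d1 by (auto simp: A_def B_def I_def d'_def)
  ultimately have "A = {} \<or> B = {}" using conn unfolding connected_closedin by blast
  then show thesis
  proof
    assume "B = {}"
    then have "\<forall>t\<in>I. g t = 0" using \<open>I \<subseteq> A \<union> B\<close> by (auto simp: A_def)
    then show thesis using d' that by (auto simp: I_def)
  next
    assume "A = {}"
    then have nz: "0 \<notin> g ` I" by (auto simp: A_def)
    have "connected (g ` I)" using gI conn by (rule connected_continuous_image)
    then have "\<not> (x < 0 \<and> 0 < y)" if "x \<in> g ` I" "y \<in> g ` I" for x y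
      using that nz connectedD_interval[of "g ` I" x y 0] by auto
    then have "(\<forall>t\<in>I. g t > 0) \<or> (\<forall>t\<in>I. g t < 0)"
      using nz by (metis imageI linorder_neqE_linordered_idom)
    then show thesis using d' that by (auto simp: I_def)
  qed
qed

section \<open>Branches of plane algebraic curves\<close>

lemma eventually_at_right_0_less: "d > 0 \<Longrightarrow> \<forall>\<^sub>F t in at_right (0::real). 0 < t \<and> t < d"
  unfolding eventually_at_right_field by (rule exI[of _ d]) auto

text \<open>A relation \<open>q\<close> of least degree that still holds at parameters accumulating
  at 0 has no multiple that splits into factors of lower degree, since one factor would hold
  frequently too. Hence \<open>q\<close> and its derivative generate a nonzero \<open>D\<close> of
  degree 0, which rules out multiple roots wherever D(t) \<noteq> 0.\<close>

lemma separable_relation: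
  assumes "p \<noteq> 0" "\<exists>\<^sub>F t in at_right 0. t \<in> T \<and> eval2 p t (x t) = 0"
  obtains q a b D where "\<exists>\<^sub>F t in at_right 0. t \<in> T \<and> eval2 q t (x t) = 0"
    "degree q > 0" "D \<noteq> 0" "a * q + b * pderiv q = [:D:]"
proof -
  define R where "R = (\<lambda>p. p \<noteq> 0 \<and> (\<exists>\<^sub>F t in at_right 0. t \<in> T \<and> eval2 p t (x t) = 0))"
  obtain q where q: "R q" and min: "\<And>r. R r \<Longrightarrow> degree q \<le> degree r"
    using ex_has_least_nat[of R p degree] assms unfolding R_def by blast
  \<comment> \<open>A nonzero polynomial in t alone has no zeros in some interval (0, d), so it
    cannot hold frequently as a relation.\<close>
  have const: "\<not> R [:c:]" for c
  proof
    assume R: "R [:c:]"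
    then have "c \<noteq> 0" by (auto simp: R_def)
    then obtain d where d: "d > 0" "\<And>t. 0 < t \<Longrightarrow> t < d \<Longrightarrow> poly c t \<noteq> 0"
      using poly_nonzero_near_0 by blast
    have "\<forall>\<^sub>F t in at_right 0. \<not> (t \<in> T \<and> eval2 [:c:] t (x t) = 0)"
      using eventually_at_right_0_less[OF d(1)] by eventually_elim (use d in auto)
    then show False using R by (simp add: R_def frequently_def)
  qed
  have deg: "degree q > 0" using q const by (metis degree_eq_zeroE gr0I)
  define J where "J = (\<lambda>g. g \<noteq> 0 \<and> (\<exists>a b. g = a * q + b * pderiv q))"
  have "q = 1 * q + 0 * pderiv q" by simp
  then have "J q" using q unfolding J_def R_def by blast
  then obtain g where g: "J g" and gmin: "\<And>r. J r \<Longrightarrow> degree g \<le> degree r"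
    using ex_has_least_nat[of J q degree] by blast
  obtain a b where ab: "g = a * q + b * pderiv q" using g by (auto simp: J_def)
  have "degree g = 0"
  proof (rule ccontr)
    assume g0: "degree g \<noteq> 0"
    have "pderiv q = 0 * q + 1 * pderiv q" "pderiv q \<noteq> 0" using deg by (auto simp: pderiv_eq_0_iff)
    then have "J (pderiv q)" unfolding J_def by blast
    then have "degree g \<le> degree (pderiv q)" by (rule gmin)
    then have lt: "degree g < degree q" using deg by (simp add: degree_pderiv)
    have gne: "g \<noteq> 0" using g by (simp add: J_def)
    \<comment> \<open>Since \<real>[t] is not a field, only a multiple of \<open>q\<close> is
      divided by \<open>g\<close>; a nonzero pseudo-remainder would lie in the ideal of
      \<open>q\<close> and its derivative with smaller degree than \<open>g\<close>.\<close>
    obtain c h where ch: "c \<noteq> 0" "Polynomial.smult c q = g * h + pseudo_mod q g"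
      using pseudo_mod(1)[OF gne] by blast
    have "pseudo_mod q g = 0"
    proof (rule ccontr)
      assume r: "pseudo_mod q g \<noteq> 0"
      have "pseudo_mod q g = Polynomial.smult c q - g * h" using ch(2) by simp
      also have "\<dots> = ([:c:] - h * a) * q + (- (h * b)) * pderiv q"
        by (simp add: ab algebra_simps)
      finally have "J (pseudo_mod q g)" using r unfolding J_def by blast
      then have "degree g \<le> degree (pseudo_mod q g)" by (rule gmin)
      then show False using pseudo_mod(2)[OF gne, of q] r by auto
    qed
    then have eq: "Polynomial.smult c q = g * h" using ch by simp
    have q0: "q \<noteq> 0" using deg by auto
    then have h0: "h \<noteq> 0" using eq ch(1) by (metis mult_zero_right smult_eq_0_iff)
    have "degree q = degree g + degree h"
      using arg_cong[OF eq, of degree] ch(1) gne h0 by (simp add: degree_mult_eq)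
    then have lt': "degree h < degree q" using g0 by simp
    have zero: "eval2 g t (x t) = 0 \<or> eval2 h t (x t) = 0" if "eval2 q t (x t) = 0" for t
    proof -
      have "eval2 (Polynomial.smult c q) t (x t) = 0" using that by simp
      then show ?thesis unfolding eq by simp
    qed
    have "\<exists>\<^sub>F t in at_right 0. (t \<in> T \<and> eval2 g t (x t) = 0) \<or> (t \<in> T \<and> eval2 h t (x t) = 0)"
      using q unfolding R_def by (elim conjE frequently_elim1) (use zero in blast)
    then have "R g \<or> R h" using gne h0 by (simp add: R_def frequently_disj_iff)
    then show False using min lt lt' by (meson not_le)
  qed
  then obtain D where D: "g = [:D:]" by (metis degree_eq_zeroE)
  show thesis
  proof (rule that[of q D a b])
    show "D \<noteq> 0" using g D by (auto simp: J_def)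
    show "a * q + b * pderiv q = [:D:]" using ab D by simp
  qed (use q deg in \<open>auto simp: R_def\<close>)
qed

section \<open>Continuity of the real roots in the parameter\<close>

text \<open>Cauchy's root bound; it keeps roots from escaping to infinity while the parameter moves
  and the leading coefficient stays away from 0.\<close>

lemma poly_root_bound:
  fixes c :: "nat \<Rightarrow> real"
  assumes "(\<Sum>k\<le>n. c k * x ^ k) = 0" "c n \<noteq> 0"
  shows "\<bar>x\<bar> \<le> 1 + (\<Sum>k<n. \<bar>c k\<bar>) / \<bar>c n\<bar>"
proof (cases "\<bar>x\<bar> \<le> 1")
  case True
  have "0 \<le> (\<Sum>k<n. \<bar>c k\<bar>) / \<bar>c n\<bar>" by (intro divide_nonneg_nonneg sum_nonneg) auto
  then show ?thesis using True by linarith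
next
  case False
  have n: "n > 0" using assms by (intro gr0I) auto
  have "c n * x ^ n = - (\<Sum>k<n. c k * x ^ k)"
    using assms(1) by (simp add: lessThan_Suc_atMost[symmetric])
  then have "\<bar>c n\<bar> * \<bar>x\<bar> ^ n = \<bar>\<Sum>k<n. c k * x ^ k\<bar>"
    by (metis abs_minus_cancel abs_mult power_abs)
  also have "\<dots> \<le> (\<Sum>k<n. \<bar>c k\<bar> * \<bar>x\<bar> ^ k)"
    by (rule sum_abs[THEN order_trans]) (simp add: abs_mult power_abs)
  also have "\<dots> \<le> (\<Sum>k<n. \<bar>c k\<bar> * \<bar>x\<bar> ^ (n - 1))"
    using False by (intro sum_mono mult_left_mono power_increasing) auto
  also have "\<dots> = (\<Sum>k<n. \<bar>c k\<bar>) * \<bar>x\<bar> ^ (n - 1)" by (simp add: sum_distrib_right)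
  finally have "(\<bar>c n\<bar> * \<bar>x\<bar>) * \<bar>x\<bar> ^ (n - 1) \<le> (\<Sum>k<n. \<bar>c k\<bar>) * \<bar>x\<bar> ^ (n - 1)"
    using n by (cases n) (simp_all add: mult.assoc)
  then have "\<bar>c n\<bar> * \<bar>x\<bar> \<le> (\<Sum>k<n. \<bar>c k\<bar>)"
    using False by (subst (asm) mult_le_cancel_right_pos) auto
  then have "\<bar>x\<bar> \<le> (\<Sum>k<n. \<bar>c k\<bar>) / \<bar>c n\<bar>"
    using assms(2) by (simp add: field_simps)
  then show ?thesis by linarith
qed

lemma eventually_compact_nonzero:
  assumes "compact K" "\<And>y. y \<in> K \<Longrightarrow> eval2 p t0 y \<noteq> 0"
  shows "\<forall>\<^sub>F t in nhds t0. \<forall>y\<in>K. eval2 p t y \<noteq> 0"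
proof -
  define W where "W = {z. eval2 p (fst z) (snd z) \<noteq> 0}"
  have "open W" unfolding W_def
    by (intro open_Collect_neq continuous_eval2 continuous_intros)
  moreover have "{t0} \<times> K \<subseteq> W" using assms(2) by (auto simp: W_def)
  ultimately have "\<exists>X0. t0 \<in> X0 \<and> open X0 \<and> X0 \<times> K \<subseteq> W"
    by (rule Elementary_Topology.tube_lemma[OF assms(1)])
  then obtain X0 where X0: "t0 \<in> X0" "open X0" "X0 \<times> K \<subseteq> W" by (elim exE conjE)
  have "eval2 p t y \<noteq> 0" if "t \<in> X0" "y \<in> K" for t y
    using subsetD[OF X0(3), of "(t, y)"] that by (simp add: W_def)
  then show ?thesis unfolding eventually_nhds using X0(1,2) by blast
qed

lemma eval2_DERIV: "((\<lambda>y. eval2 p t y) has_real_derivative eval2 (pderiv p) t y) (at y)"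
proof -
  have "map_poly (\<lambda>c. poly c t) (pderiv p) = pderiv (map_poly (\<lambda>c. poly c t) p)"
    by (rule poly_eqI) (simp add: coeff_map_poly coeff_pderiv poly_of_nat)
  then show ?thesis by (simp add: poly_poly_const)
qed

lemma eval2_roots_finite:
  assumes "poly (lead_coeff p) t \<noteq> 0"
  shows "finite {x. eval2 p t x = 0}"
proof -
  have "coeff (map_poly (\<lambda>c. poly c t) p) (degree p) \<noteq> 0" using assms by (simp add: coeff_map_poly)
  then have "map_poly (\<lambda>c. poly c t) p \<noteq> 0" by (metis coeff_0)
  then show ?thesis using poly_roots_finite by (simp add: poly_poly_const)
qed

text \<open>By connectedness the derivative has one sign on the ball, so \<open>f\<close> passes
  strictly monotonically through its zero \<open>x\<close>.\<close>

lemma sign_change_of_DERIV_nonzero: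
  fixes f :: "real \<Rightarrow> real"
  assumes der: "\<And>y. (f has_real_derivative f' y) (at y)" and e: "e > 0" and "f x = 0"
    and nz: "\<And>y. y \<in> cball x e \<Longrightarrow> f' y \<noteq> 0" and cont: "continuous_on (cball x e) f'"
  shows "f (x - e) * f (x + e) < 0"
proof -
  have "connected (f' ` cball x e)" using cont by (rule connected_continuous_image) simp
  then have sgn: "\<not> (a < 0 \<and> 0 < b)" if "a \<in> f' ` cball x e" "b \<in> f' ` cball x e" for a b
    using that nz connectedD_interval[of "f' ` cball x e" a b 0] by force
  have mem: "y \<in> cball x e" if "x - e \<le> y" "y \<le> x + e" for y using that by (auto simp: dist_real_def)
  show ?thesis
  proof (cases "f' x > 0")
    case True
    have "f' y > 0" if "x - e \<le> y" "y \<le> x + e" for y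
      using sgn[of "f' y" "f' x"] True nz[OF mem[OF that]] mem[OF that] e by force
    then have "f (x - e) < f x" "f x < f (x + e)"
      using e der by (auto intro!: DERIV_pos_imp_increasing[of _ _ f] exI[of _ "f' _"])
    then show ?thesis using assms(3) by (simp add: mult_neg_pos)
  next
    case False
    then have "f' x < 0" using nz[of x] e by auto
    then have "f' y < 0" if "x - e \<le> y" "y \<le> x + e" for y
      using sgn[of "f' x" "f' y"] nz[OF mem[OF that]] mem[OF that] e by force
    then have "f x < f (x - e)" "f (x + e) < f x"
      using e der by (auto intro!: DERIV_neg_imp_decreasing[of _ _ f] exI[of _ "f' _"])
    then show ?thesis using assms(3) by (simp add: mult_pos_neg)
  qed
qed

text \<open>Put small disjoint balls around the roots at \<open>t0\<close>. For nearby
  \<open>t\<close> a sign change gives a root in each ball, the nonvanishing derivative makes it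
  unique, and compactness together with the root bound excludes roots elsewhere. The matching
  preserves the order because the balls are disjoint.\<close>

lemma eval2_roots_stable:
  assumes lc: "poly (lead_coeff p) t0 \<noteq> 0"
    and simple: "\<And>x. eval2 p t0 x = 0 \<Longrightarrow> eval2 (pderiv p) t0 x \<noteq> 0" and e0: "e0 > 0"
  shows "\<forall>\<^sub>F t in nhds t0. \<exists>\<phi>. strict_mono_on {x. eval2 p t0 x = 0} \<phi> \<and>
    \<phi> ` {x. eval2 p t0 x = 0} = {x. eval2 p t x = 0} \<and> (\<forall>x. eval2 p t0 x = 0 \<longrightarrow> \<bar>\<phi> x - x\<bar> < e0)"
proof -
  define A where "A = {x. eval2 p t0 x = 0}"
  have finA: "finite A" unfolding A_def by (rule eval2_roots_finite[OF lc])
  have cont: "isCont (\<lambda>t. eval2 r t y) s" for r y s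
    using continuous_eval2[of UNIV "\<lambda>t. t" "\<lambda>_. y" r]
    by (simp add: continuous_on_eq_continuous_at)
  have cont2: "continuous_on S (\<lambda>y. eval2 r t y)" for r t S
    by (intro continuous_eval2 continuous_intros)
  have "\<forall>\<^sub>F e in at_right 0. \<forall>x\<in>A. \<forall>y\<in>cball x (2 * e). eval2 (pderiv p) t0 y \<noteq> 0"
  proof (rule eventually_ball_finite[OF finA], rule ballI)
    fix x assume x: "x \<in> A"
    have "open {y. eval2 (pderiv p) t0 y \<noteq> 0}"
      by (intro open_Collect_neq cont2 continuous_intros)
    moreover have "x \<in> {y. eval2 (pderiv p) t0 y \<noteq> 0}" using x simple by (simp add: A_def)
    ultimately obtain d where d: "d > 0" "cball x d \<subseteq> {y. eval2 (pderiv p) t0 y \<noteq> 0}"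
      unfolding open_contains_cball by blast
    have "\<forall>\<^sub>F e in at_right 0. 0 < e \<and> e < d / 2" using d by (intro eventually_at_right_0_less) simp
    then show "\<forall>\<^sub>F e in at_right 0. \<forall>y\<in>cball x (2 * e). eval2 (pderiv p) t0 y \<noteq> 0"
    proof eventually_elim
      case (elim e)
      then have "cball x (2 * e) \<subseteq> cball x d" by (intro subset_cball) simp
      then show ?case using d(2) by blast
    qed
  qed
  then have "\<forall>\<^sub>F e in at_right 0. (\<forall>x\<in>A. \<forall>y\<in>cball x (2 * e). eval2 (pderiv p) t0 y \<noteq> 0)
      \<and> 0 < e \<and> e < e0"
    using eventually_at_right_0_less[OF e0] by (rule eventually_conj)
  then obtain e where e: "0 < e" "e < e0"
    and nz: "\<And>x y. x \<in> A \<Longrightarrow> y \<in> cball x (2 * e) \<Longrightarrow> eval2 (pderiv p) t0 y \<noteq> 0"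
    using eventually_happens'[OF trivial_limit_at_right_real] by blast
  \<comment> \<open>Between two roots at distance at most 2e the mean value theorem would give a
    zero of the derivative within 2e of a root; hence balls of radius \<open>e\<close> are
    disjoint.\<close>
  have sep: "2 * e < y - x" if xy: "x \<in> A" "y \<in> A" "x < y" for x y
  proof (rule ccontr)
    assume le: "\<not> ?thesis"
    obtain z where z: "x < z" "z < y"
        "eval2 p t0 y - eval2 p t0 x = (y - x) * eval2 (pderiv p) t0 z"
      using MVT2[OF xy(3), of "\<lambda>y. eval2 p t0 y" "\<lambda>y. eval2 (pderiv p) t0 y"] eval2_DERIV by blast
    then have "z \<in> cball x (2 * e)" using le by (simp add: dist_real_def)
    then show False using nz[OF xy(1)] z(3) xy by (simp add: A_def)
  qed
  define n where "n = degree p"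
  define Bd where "Bd t = 1 + (\<Sum>k<n. \<bar>poly (coeff p k) t\<bar>) / \<bar>poly (coeff p n) t\<bar>" for t
  have contB: "isCont Bd t0"
    unfolding Bd_def using lc by (intro continuous_intros) (auto simp: n_def)
  \<comment> \<open>The margin 1 leaves room for the root bound to vary, so that for nearby
    \<open>t\<close> all roots lie between -M and M.\<close>
  define M where "M = Bd t0 + 1"
  define K where "K = {-M..M} - (\<Union>x\<in>A. ball x e)"
  have "compact K" unfolding K_def by (intro compact_diff compact_Icc open_UN ballI open_ball)
  moreover have "eval2 p t0 y \<noteq> 0" if "y \<in> K" for y
    using that e by (auto simp: K_def A_def)
  ultimately have ev1: "\<forall>\<^sub>F t in nhds t0. \<forall>y\<in>K. eval2 p t y \<noteq> 0"
    by (rule eventually_compact_nonzero)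
  have ev2: "\<forall>\<^sub>F t in nhds t0. \<forall>x\<in>A. \<forall>y\<in>cball x e. eval2 (pderiv p) t y \<noteq> 0"
  proof (rule eventually_ball_finite[OF finA], rule ballI)
    fix x assume "x \<in> A"
    then show "\<forall>\<^sub>F t in nhds t0. \<forall>y\<in>cball x e. eval2 (pderiv p) t y \<noteq> 0"
      by (intro eventually_compact_nonzero nz[of x]) (use e in auto)
  qed
  have ev3: "\<forall>\<^sub>F t in nhds t0. \<forall>x\<in>A. eval2 p t (x - e) * eval2 p t (x + e) < 0"
  proof (rule eventually_ball_finite[OF finA], rule ballI)
    fix x assume x: "x \<in> A"
    have "eval2 p t0 (x - e) * eval2 p t0 (x + e) < 0"
    proof (rule sign_change_of_DERIV_nonzero[OF eval2_DERIV e(1)])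
      fix y assume "y \<in> cball x e"
      then show "eval2 (pderiv p) t0 y \<noteq> 0" using nz[OF x] e by auto
    qed (use x cont2 in \<open>auto simp: A_def\<close>)
    moreover have "((\<lambda>t. eval2 p t (x - e) * eval2 p t (x + e)) \<longlongrightarrow>
        eval2 p t0 (x - e) * eval2 p t0 (x + e)) (nhds t0)"
      by (intro tendsto_mult) (use cont in \<open>auto simp: isCont_def tendsto_nhds_iff\<close>)
    ultimately show "\<forall>\<^sub>F t in nhds t0. eval2 p t (x - e) * eval2 p t (x + e) < 0"
      using order_tendstoD(2) by blast
  qed
  have ev4: "\<forall>\<^sub>F t in nhds t0. Bd t < M"
    using contB by (intro order_tendstoD(2)[of Bd "Bd t0"]) (auto simp: isCont_def tendsto_nhds_iff M_def)
  have ev5: "\<forall>\<^sub>F t in nhds t0. poly (coeff p n) t \<noteq> 0"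
    using eventually_compact_nonzero[of "{0}" "[:coeff p n:]" t0] lc by (simp add: n_def)
  show ?thesis
    using ev1 ev2 ev3 ev4 ev5
  proof eventually_elim
    case (elim t)
    have ex: "\<exists>y. y \<in> ball x e \<and> eval2 p t y = 0" if x: "x \<in> A" for x
    proof -
      have "connected ((\<lambda>y. eval2 p t y) ` {x - e..x + e})"
        by (intro connected_continuous_image cont2) simp
      moreover have "eval2 p t (x - e) * eval2 p t (x + e) < 0" using elim x by blast
      ultimately have "0 \<in> (\<lambda>y. eval2 p t y) ` {x - e..x + e}"
        using e connectedD_interval[of "(\<lambda>y. eval2 p t y) ` {x - e..x + e}"
            "eval2 p t (x - e)" "eval2 p t (x + e)" 0]
          connectedD_interval[of "(\<lambda>y. eval2 p t y) ` {x - e..x + e}"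
            "eval2 p t (x + e)" "eval2 p t (x - e)" 0]
        by (auto simp: mult_less_0_iff)
      then obtain y where y: "x - e \<le> y" "y \<le> x + e" "eval2 p t y = 0" by auto
      moreover have "y \<noteq> x - e" "y \<noteq> x + e" using y elim x by force+
      ultimately show ?thesis by (auto simp: dist_real_def intro!: exI[of _ y])
    qed
    have no_two: "\<not> y < z" if x: "x \<in> A" and y: "y \<in> ball x e" "eval2 p t y = 0"
      and z: "z \<in> ball x e" "eval2 p t z = 0" for x y z
    proof
      assume yz: "y < z"
      obtain w where w: "y < w" "w < z"
          "eval2 p t z - eval2 p t y = (z - y) * eval2 (pderiv p) t w"
        using MVT2[OF yz, of "\<lambda>y. eval2 p t y" "\<lambda>y. eval2 (pderiv p) t y"] eval2_DERIV by blast
      then have "w \<in> cball x e" using y z by (auto simp: dist_real_def)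
      then have "eval2 (pderiv p) t w \<noteq> 0" using elim x by blast
      then show False using w(3) y z yz by simp
    qed
    have uniq: "y = z" if "x \<in> A" "y \<in> ball x e" "eval2 p t y = 0" "z \<in> ball x e" "eval2 p t z = 0"
      for x y z using no_two[OF that] no_two[OF that(1,4,5,2,3)] by simp
    define \<phi> where "\<phi> x = (SOME y. y \<in> ball x e \<and> eval2 p t y = 0)" for x
    have \<phi>: "\<phi> x \<in> ball x e" "eval2 p t (\<phi> x) = 0" if "x \<in> A" for x
      using someI_ex[OF ex[OF that]] by (auto simp: \<phi>_def)
    have "strict_mono_on A \<phi>"
    proof (rule strict_mono_onI)
      fix x y assume xy: "x \<in> A" "y \<in> A" "x < y"
      then show "\<phi> x < \<phi> y" using sep[of x y] \<phi>(1)[of x] \<phi>(1)[of y] by (auto simp: dist_real_def)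
    qed
    moreover have "\<phi> ` A = {x. eval2 p t x = 0}"
    proof
      show "\<phi> ` A \<subseteq> {x. eval2 p t x = 0}" using \<phi> by auto
      show "{x. eval2 p t x = 0} \<subseteq> \<phi> ` A"
      proof
        fix y assume "y \<in> {x. eval2 p t x = 0}"
        then have y: "eval2 p t y = 0" by simp
        then have "\<bar>y\<bar> \<le> Bd t"
          unfolding Bd_def using elim by (intro poly_root_bound) (simp_all add: eval2_altdef n_def)
        then have "y \<in> {-M..M}" using elim by auto
        moreover have "y \<notin> K" using elim y by auto
        ultimately obtain x where x: "x \<in> A" "y \<in> ball x e" by (auto simp: K_def)
        then have "y = \<phi> x" using uniq y \<phi> by blast
        then show "y \<in> \<phi> ` A" using x by blast
      qed
    qed
    moreover have "\<bar>\<phi> x - x\<bar> < e0" if "x \<in> A" for x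
      using \<phi>(1)[OF that] e by (auto simp: dist_real_def)
    ultimately show ?case by (auto simp: A_def intro!: exI[of _ \<phi>])
  qed
qed

text \<open>The sorted list of real roots has locally constant, hence constant, length, and its
  entries are continuous. The given values \<open>x t\<close> occupy one of finitely many positions,
  so some position is taken at parameters accumulating at 0.\<close>

lemma root_branch:
  assumes d: "d > 0" and lc: "\<And>t. t \<in> {0<..<d} \<Longrightarrow> poly (lead_coeff p) t \<noteq> 0"
    and simple: "\<And>t x. t \<in> {0<..<d} \<Longrightarrow> eval2 p t x = 0 \<Longrightarrow> eval2 (pderiv p) t x \<noteq> 0"
    and freq: "\<exists>\<^sub>F t in at_right 0. t \<in> T \<and> eval2 p t (x t) = 0"
  obtains b where "continuous_on {0<..<d} b" "\<forall>t\<in>{0<..<d}. eval2 p t (b t) = 0"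
    "\<exists>\<^sub>F t in at_right 0. t \<in> T \<and> x t = b t"
proof -
  define L where "L t = sorted_list_of_set {x. eval2 p t x = 0}" for t
  have fin: "finite {x. eval2 p t x = 0}" if "t \<in> {0<..<d}" for t
    by (rule eval2_roots_finite[OF lc[OF that]])
  have setL: "set (L t) = {x. eval2 p t x = 0}" if "t \<in> {0<..<d}" for t
    using fin[OF that] by (simp add: L_def)
  have stable: "\<forall>\<^sub>F t in nhds t0. length (L t) = length (L t0) \<and>
      (\<forall>j<length (L t0). \<bar>L t ! j - L t0 ! j\<bar> < e)" if t0: "t0 \<in> {0<..<d}" and e: "e > 0" for t0 e
  proof -
    have "\<forall>\<^sub>F t in nhds t0. t \<in> {0<..<d}" using t0 by (intro eventually_nhds_in_open) auto
    moreover have "\<forall>\<^sub>F t in nhds t0. \<exists>\<phi>. strict_mono_on {x. eval2 p t0 x = 0} \<phi> \<and>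
        \<phi> ` {x. eval2 p t0 x = 0} = {x. eval2 p t x = 0} \<and>
        (\<forall>x. eval2 p t0 x = 0 \<longrightarrow> \<bar>\<phi> x - x\<bar> < e)"
      using lc[OF t0] simple[OF t0] e by (rule eval2_roots_stable)
    ultimately show ?thesis
    proof eventually_elim
      case (elim t)
      then obtain \<phi> where \<phi>: "strict_mono_on {x. eval2 p t0 x = 0} \<phi>"
          "\<phi> ` {x. eval2 p t0 x = 0} = {x. eval2 p t x = 0}"
          "\<forall>x. eval2 p t0 x = 0 \<longrightarrow> \<bar>\<phi> x - x\<bar> < e" by blast
      \<comment> \<open>The order-preserving matching carries the sorted list at \<open>t0\<close>
        to the sorted list at \<open>t\<close>, position by position.\<close>
      have "sorted_wrt (\<lambda>a b. \<phi> a < \<phi> b) (L t0)"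
        by (rule sorted_wrt_mono_rel[of _ "(<)"])
          (use setL[OF t0] \<phi>(1) in \<open>auto simp: L_def strict_mono_on_def\<close>)
      then have "sorted_wrt (<) (map \<phi> (L t0))" by (simp add: sorted_wrt_map)
      moreover have "sorted_wrt (<) (L t)" by (simp add: L_def)
      moreover have "set (map \<phi> (L t0)) = set (L t)"
        using \<phi>(2) setL[OF t0] setL elim by simp
      ultimately have eq: "L t = map \<phi> (L t0)" by (metis strict_sorted_equal)
      have "\<bar>\<phi> (L t0 ! j) - L t0 ! j\<bar> < e" if "j < length (L t0)" for j
        using \<phi>(3) setL[OF t0] nth_mem[OF that] by blast
      then show ?case unfolding eq by simp
    qed
  qed
  have "(\<lambda>t. length (L t)) constant_on {0<..<d}"
  proof (rule locally_constant_imp_constant)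
    fix a assume a: "a \<in> {0<..<d}"
    from stable[OF a, of 1] obtain S where S: "open S" "a \<in> S"
        "\<And>t. t \<in> S \<Longrightarrow> length (L t) = length (L a)"
      unfolding eventually_nhds by (auto simp del: greaterThanLessThan_iff)
    then show "\<exists>S. openin (top_of_set {0<..<d}) S \<and> a \<in> S \<and> (\<forall>t\<in>S. length (L t) = length (L a))"
    proof (intro exI conjI ballI)
      show "openin (top_of_set {0<..<d}) ({0<..<d} \<inter> S)" by (rule openin_open_Int[OF S(1)])
      show "a \<in> {0<..<d} \<inter> S" using a S(2) by blast
      show "length (L t) = length (L a)" if "t \<in> {0<..<d} \<inter> S" for t using that by (intro S(3)) blast
    qed
  qed simp
  then obtain N where N: "\<And>t. t \<in> {0<..<d} \<Longrightarrow> length (L t) = N"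
    unfolding constant_on_def by blast
  have "\<exists>\<^sub>F t in at_right 0. (t \<in> T \<and> eval2 p t (x t) = 0) \<and> 0 < t \<and> t < d"
    using frequently_eventually_frequently[OF freq eventually_at_right_0_less[OF d]] .
  then have "\<exists>\<^sub>F t in at_right 0. \<exists>j\<in>{..<N}. t \<in> T \<and> x t = L t ! j"
  proof (rule frequently_elim1)
    fix t assume t: "(t \<in> T \<and> eval2 p t (x t) = 0) \<and> 0 < t \<and> t < d"
    then have "x t \<in> set (L t)" using setL by auto
    then obtain j where "j < length (L t)" "L t ! j = x t" by (auto simp: in_set_conv_nth)
    then show "\<exists>j\<in>{..<N}. t \<in> T \<and> x t = L t ! j" using t N[of t] by (intro bexI[of _ j]) auto
  qed
  then have "\<exists>j\<in>{..<N}. \<exists>\<^sub>F t in at_right 0. t \<in> T \<and> x t = L t ! j"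
    by (rule frequently_bex_finite[rotated]) simp
  then obtain j where j: "j < N" "\<exists>\<^sub>F t in at_right 0. t \<in> T \<and> x t = L t ! j" by blast
  show thesis
  proof (rule that[of "\<lambda>t. L t ! j"])
    have "isCont (\<lambda>t. L t ! j) t0" if t0: "t0 \<in> {0<..<d}" for t0
      unfolding isCont_def tendsto_iff dist_real_def
    proof (intro allI impI)
      fix e :: real assume "e > 0"
      from stable[OF t0 this] have "\<forall>\<^sub>F t in nhds t0. \<bar>L t ! j - L t0 ! j\<bar> < e"
        by eventually_elim (use j N[OF t0] in auto)
      then show "\<forall>\<^sub>F t in at t0. \<bar>L t ! j - L t0 ! j\<bar> < e" by (simp add: eventually_nhds_conv_at)
    qed
    then show "continuous_on {0<..<d} (\<lambda>t. L t ! j)" by (intro continuous_at_imp_continuous_on) blast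
  next
    show "\<forall>t\<in>{0<..<d}. eval2 p t (L t ! j) = 0"
    proof
      fix t assume t: "t \<in> {0<..<d}"
      then have "L t ! j \<in> set (L t)" using j N by (intro nth_mem) simp
      then show "eval2 p t (L t ! j) = 0" using setL[OF t] by blast
    qed
  qed (rule j)
qed

section \<open>Derivatives of branches\<close>

lemma poly_map_pderiv_const: "poly (map_poly pderiv p) [:y:] = pderiv (poly p [:y:])"
  for p :: "real poly poly"
  by (induction p) (simp_all add: map_poly_pCons pderiv_add pderiv_smult)

text \<open>Dividing \<open>p\<close> by y - b(t0) and the remainder by t - t0 writes the difference
  quotient of \<open>b\<close> as a quotient with a limit at \<open>t0\<close>, so continuity of the
  branch suffices for its differentiability. Here \<open>map_poly pderiv p\<close> is the partial
  derivative in t and \<open>pderiv p\<close> the one in the other variable.\<close>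

lemma implicit_DERIV:
  assumes cont: "isCont b t0" and root: "\<forall>\<^sub>F t in nhds t0. eval2 p t (b t) = 0"
    and simple: "eval2 (pderiv p) t0 (b t0) \<noteq> 0"
  shows "(b has_real_derivative
    - eval2 (map_poly pderiv p) t0 (b t0) / eval2 (pderiv p) t0 (b t0)) (at t0)"
proof -
  define S where "S = synthetic_div p [:b t0:]"
  define r where "r = poly p [:b t0:]"
  define s where "s = synthetic_div r t0"
  have p: "p = [:- [:b t0:], 1:] * S + [:r:]"
    unfolding S_def r_def by (rule synthetic_div_correct'[symmetric])
  have eval_p: "eval2 p t y = (y - b t0) * eval2 S t y + poly r t" for t y
    by (subst p) (simp add: algebra_simps)
  have r0: "poly r t0 = 0" using eventually_nhds_x_imp_x[OF root] by (simp add: r_def)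
  have r: "r = [:- t0, 1:] * s" using synthetic_div_correct'[of t0 r] r0 by (simp add: s_def)
  have S0: "eval2 (pderiv p) t0 (b t0) = eval2 S t0 (b t0)"
    by (subst p) (simp add: pderiv_add pderiv_mult pderiv_pCons pderiv_smult)
  have s0: "eval2 (map_poly pderiv p) t0 (b t0) = poly s t0"
    unfolding poly_map_pderiv_const r_def[symmetric]
    by (subst r) (simp add: pderiv_mult pderiv_pCons pderiv_smult pderiv_diff)
  have contS: "isCont (\<lambda>t. eval2 S t (b t)) t0"
  proof -
    have "continuous_on UNIV (\<lambda>z. eval2 S (fst z) (snd z))"
      by (intro continuous_eval2 continuous_intros)
    then have "isCont (\<lambda>z. eval2 S (fst z) (snd z)) (t0, b t0)"
      by (simp add: continuous_on_eq_continuous_at)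
    then have "isCont ((\<lambda>z. eval2 S (fst z) (snd z)) \<circ> (\<lambda>t. (t, b t))) t0"
      by (intro continuous_at_compose continuous_Pair continuous_ident cont) simp
    then show ?thesis by (simp add: comp_def)
  qed
  have Snz: "\<forall>\<^sub>F t in at t0. eval2 S t (b t) \<noteq> 0"
    by (rule tendsto_imp_eventually_ne[OF contS[unfolded isCont_def]]) (use simple S0 in simp)
  have "\<forall>\<^sub>F t in at t0. - poly s t / eval2 S t (b t) = (b t - b t0) / (t - t0)"
    using Snz eventually_nhds_conv_at[THEN iffD1, OF root, THEN conjunct1] eventually_neq_at_within[of t0 t0 UNIV]
  proof eventually_elim
    case (elim t)
    then have "(b t - b t0) * eval2 S t (b t) = - ((t - t0) * poly s t)"
      using eval_p[of "b t" t] by (simp add: r algebra_simps)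
    then show ?case using elim by (simp add: field_simps)
  qed
  moreover have "((\<lambda>t. - poly s t / eval2 S t (b t)) \<longlongrightarrow> - poly s t0 / eval2 S t0 (b t0)) (at t0)"
    using contS simple S0 unfolding isCont_def by (intro tendsto_intros) auto
  ultimately have "((\<lambda>t. (b t - b t0) / (t - t0)) \<longlongrightarrow> - poly s t0 / eval2 S t0 (b t0)) (at t0)"
    by (rule Lim_transform_eventually[rotated])
  then show ?thesis by (simp add: has_field_derivative_iff S0 s0)
qed

section \<open>Algebraic relations in the limit of large penalty weight\<close>

lemma poly_map_poly_altdef:
  fixes f :: "'a::zero \<Rightarrow> 'b::comm_ring_1"
  assumes "f 0 = 0"
  shows "poly (map_poly f p) x = (\<Sum>k\<le>degree p. f (coeff p k) * x ^ k)"
proof -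
  have "poly (map_poly f p) x = (\<Sum>k\<le>degree (map_poly f p). f (coeff p k) * x ^ k)"
    using assms by (simp add: poly_altdef coeff_map_poly)
  also have "\<dots> = (\<Sum>k\<le>degree p. f (coeff p k) * x ^ k)"
  proof (rule sum.mono_neutral_left)
    show "{..degree (map_poly f p)} \<subseteq> {..degree p}" using degree_map_poly_le[of f p] by simp
    have "coeff (map_poly f p) k = 0" if "k > degree (map_poly f p)" for k
      using that by (rule coeff_eq_0)
    then show "\<forall>k\<in>{..degree p} - {..degree (map_poly f p)}. f (coeff p k) * x ^ k = 0"
      using assms by (auto simp: coeff_map_poly)
  qed simp
  finally show ?thesis .
qed

text \<open>Sort \<open>P\<close> by powers of the large variable, with coefficient
  \<open>Q j\<close> at s^j. Dividing by the highest power that occurs and letting s tend to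
  infinity leaves \<open>Q J\<close> as the relation for the limit, independent of the
  sequences.\<close>

lemma limit_relation:
  fixes P :: "real poly poly poly"
  assumes "lead_coeff P = 1"
  obtains q where "q \<noteq> 0"
    "\<And>t e e' s. filterlim s at_top sequentially \<Longrightarrow> e' \<longlonglongrightarrow> e \<Longrightarrow>
      (\<And>n::nat. poly (map_poly (\<lambda>c. eval2 c t (s n)) P) (e' n) = 0) \<Longrightarrow> eval2 q t e = 0"
proof -
  define Q where "Q j = map_poly (\<lambda>c. coeff c j) P" for j
  define N where "N = (\<Sum>k\<le>degree P. degree (coeff P k))"
  have degN: "degree (coeff P k) \<le> N" if "k \<le> degree P" for k
    unfolding N_def by (rule member_le_sum) (use that in auto)
  have Q_zero: "Q j = 0" if "j > N" for j
  proof (rule poly_eqI)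
    fix k
    show "coeff (Q j) k = coeff 0 k"
    proof (cases "k \<le> degree P")
      case True
      then show ?thesis using degN[OF True] that by (simp add: Q_def coeff_map_poly coeff_eq_0)
    qed (simp add: Q_def coeff_map_poly coeff_eq_0)
  qed
  \<comment> \<open>Monicity enters here: the leading coefficient 1 contributes to the power s^0, so
    some \<open>Q j\<close> is nonzero.\<close>
  have "coeff (Q 0) (degree P) = 1" using assms by (simp add: Q_def coeff_map_poly)
  then have "Q 0 \<noteq> 0" by auto
  define J where "J = Max {j. Q j \<noteq> 0}"
  have fin: "finite {j. Q j \<noteq> 0}"
    by (rule finite_subset[of _ "{..N}"]) (use Q_zero in \<open>auto simp: not_less[symmetric]\<close>)
  have QJ: "Q J \<noteq> 0" using Max_in[OF fin] \<open>Q 0 \<noteq> 0\<close> by (auto simp: J_def)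
  have Q_above: "Q j = 0" if "j > J" for j using Max_ge[OF fin, of j] that by (auto simp: J_def)
  have expand: "poly (map_poly (\<lambda>c. eval2 c t s) P) e = (\<Sum>j\<le>J. eval2 (Q j) t e * s ^ j)" for t s e
  proof -
    have c: "eval2 (coeff P k) t s = (\<Sum>j\<le>N. poly (coeff (coeff P k) j) t * s ^ j)" if "k \<le> degree P" for k
      unfolding eval2_altdef using degN[OF that]
      by (intro sum.mono_neutral_left) (auto simp: coeff_eq_0)
    have "poly (map_poly (\<lambda>c. eval2 c t s) P) e = (\<Sum>k\<le>degree P. eval2 (coeff P k) t s * e ^ k)"
      by (rule poly_map_poly_altdef) simp
    also have "\<dots> = (\<Sum>k\<le>degree P. \<Sum>j\<le>N. poly (coeff (coeff P k) j) t * s ^ j * e ^ k)"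
      by (rule sum.cong) (simp_all add: c sum_distrib_right)
    also have "\<dots> = (\<Sum>j\<le>N. \<Sum>k\<le>degree P. poly (coeff (coeff P k) j) t * s ^ j * e ^ k)"
      by (rule sum.swap)
    also have "\<dots> = (\<Sum>j\<le>N. eval2 (Q j) t e * s ^ j)"
    proof (rule sum.cong[OF refl])
      fix j
      have "eval2 (Q j) t e = (\<Sum>k\<le>degree P. poly (coeff (coeff P k) j) t * e ^ k)"
      proof -
        have "degree (Q j) \<le> degree P" unfolding Q_def by (rule degree_map_poly_le)
        then have "(\<Sum>k\<le>degree (Q j). poly (coeff (Q j) k) t * e ^ k)
            = (\<Sum>k\<le>degree P. poly (coeff (Q j) k) t * e ^ k)"
          by (intro sum.mono_neutral_left) (auto simp: coeff_eq_0)
        then show ?thesis unfolding eval2_altdef by (simp add: Q_def coeff_map_poly)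
      qed
      then show "(\<Sum>k\<le>degree P. poly (coeff (coeff P k) j) t * s ^ j * e ^ k) = eval2 (Q j) t e * s ^ j"
        by (simp add: sum_distrib_left sum_distrib_right mult_ac)
    qed
    also have "\<dots> = (\<Sum>j\<le>max N J. eval2 (Q j) t e * s ^ j)"
      by (rule sum.mono_neutral_left) (auto simp: Q_zero)
    also have "\<dots> = (\<Sum>j\<le>J. eval2 (Q j) t e * s ^ j)"
      by (rule sum.mono_neutral_right) (auto simp: Q_above)
    finally show ?thesis .
  qed
  show thesis
  proof (rule that[OF QJ])
    fix t e e' and s :: "nat \<Rightarrow> real"
    assume s: "filterlim s at_top sequentially" and e: "e' \<longlonglongrightarrow> e"
      and zero: "\<And>n::nat. poly (map_poly (\<lambda>c. eval2 c t (s n)) P) (e' n) = 0"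
    have lim: "(\<lambda>n. eval2 (Q j) t (e' n)) \<longlonglongrightarrow> eval2 (Q j) t e" for j
    proof -
      have "continuous_on UNIV (\<lambda>y. eval2 (Q j) t y)" by (intro continuous_eval2 continuous_intros)
      then have "isCont (\<lambda>y. eval2 (Q j) t y) e" by (simp add: continuous_on_eq_continuous_at)
      then show ?thesis using e by (rule isCont_tendsto_compose)
    qed
    have inv: "(\<lambda>n. inverse (s n)) \<longlonglongrightarrow> 0" using s by (rule tendsto_inverse_0_at_top)
    have "(\<lambda>n. \<Sum>j<J. eval2 (Q j) t (e' n) * inverse (s n) ^ (J - j)) \<longlonglongrightarrow>
        (\<Sum>j<J. eval2 (Q j) t e * 0 ^ (J - j))"
      by (intro tendsto_sum tendsto_mult tendsto_power lim inv)
    also have "(\<Sum>j<J. eval2 (Q j) t e * 0 ^ (J - j)) = 0" by (intro sum.neutral) auto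
    finally have "(\<lambda>n. - (\<Sum>j<J. eval2 (Q j) t (e' n) * inverse (s n) ^ (J - j))) \<longlonglongrightarrow> - 0"
      by (rule tendsto_minus)
    moreover have "\<forall>\<^sub>F n in sequentially. - (\<Sum>j<J. eval2 (Q j) t (e' n) * inverse (s n) ^ (J - j))
        = eval2 (Q J) t (e' n)"
      using filterlim_at_top_dense[THEN iffD1, OF s, rule_format, of 0]
    proof eventually_elim
      case (elim n)
      have "(\<Sum>j<J. eval2 (Q j) t (e' n) * inverse (s n) ^ (J - j)) * s n ^ J
          = (\<Sum>j<J. eval2 (Q j) t (e' n) * s n ^ j)"
        unfolding sum_distrib_right
      proof (rule sum.cong[OF refl])
        fix j assume "j \<in> {..<J}"
        then have "s n ^ J = s n ^ (J - j) * s n ^ j" by (simp add: power_add[symmetric])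
        then show "eval2 (Q j) t (e' n) * inverse (s n) ^ (J - j) * s n ^ J = eval2 (Q j) t (e' n) * s n ^ j"
          using elim by (simp add: power_inverse field_simps)
      qed
      also have "\<dots> = - (eval2 (Q J) t (e' n)) * s n ^ J"
        using zero[of n] unfolding expand by (simp add: lessThan_Suc_atMost[symmetric])
      finally have "(\<Sum>j<J. eval2 (Q j) t (e' n) * inverse (s n) ^ (J - j)) = - eval2 (Q J) t (e' n)"
        using elim by (simp only: mult_cancel_right power_eq_0_iff) auto
      then show ?case by simp
    qed
    ultimately have "(\<lambda>n. eval2 (Q J) t (e' n)) \<longlonglongrightarrow> - 0" by (rule Lim_transform_eventually)
    then show "eval2 (Q J) t e = 0" using lim[of J] LIMSEQ_unique by fastforce
  qed
qed

section \<open>Curve selection\<close>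

text \<open>The partial derivative in coordinate \<open>i\<close>. For \<alpha> i = 0 the truncated
  exponent \<alpha> i - 1 is harmless, as the factor \<open>real (\<alpha> i)\<close>
  vanishes.\<close>

definition monomial_sum_deriv ::
    "'i \<Rightarrow> (real poly \<times> ('i::finite \<Rightarrow> nat)) list \<Rightarrow> real \<Rightarrow> ('i \<Rightarrow> real) \<Rightarrow> real" where
  "monomial_sum_deriv i l t x =
    (\<Sum>(c,\<alpha>)\<leftarrow>l. poly c t * (real (\<alpha> i) * power_prod (\<alpha>(i := \<alpha> i - 1)) x))"

lemma power_prod_DERIV:
  "((\<lambda>y. power_prod \<alpha> (x(i := y))) has_real_derivative
    real (\<alpha> i) * power_prod (\<alpha>(i := \<alpha> i - 1)) x) (at (x i))"
proof -
  define C where "C = (\<Prod>j\<in>UNIV-{i}. x j ^ \<alpha> j)"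
  have split: "power_prod \<beta> (x(i := y)) = y ^ \<beta> i * C" if "\<forall>j. j \<noteq> i \<longrightarrow> \<beta> j = \<alpha> j" for y \<beta>
  proof -
    have "(\<Prod>j\<in>UNIV-{i}. (x(i := y)) j ^ \<beta> j) = C" unfolding C_def
      by (rule prod.cong) (use that in auto)
    then show ?thesis unfolding power_prod_def by (subst prod.remove[of UNIV i]) auto
  qed
  have "power_prod (\<alpha>(i := \<alpha> i - 1)) x = x i ^ (\<alpha> i - 1) * C"
    using split[of "\<alpha>(i := \<alpha> i - 1)" "x i"] by simp
  moreover have "((\<lambda>y. y ^ \<alpha> i * C) has_real_derivative real (\<alpha> i) * (x i ^ (\<alpha> i - 1) * C)) (at (x i))"
    by (auto intro!: derivative_eq_intros)
  ultimately show ?thesis by (simp add: split)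
qed

lemma monomial_sum_DERIV:
  "((\<lambda>y. monomial_sum l t (x(i := y))) has_real_derivative monomial_sum_deriv i l t x) (at (x i))"
proof (induction l)
  case Nil
  show ?case by (simp add: monomial_sum_deriv_def)
next
  case (Cons p l)
  obtain c \<alpha> where p: "p = (c, \<alpha>)" by (cases p)
  have "((\<lambda>y. poly c t * power_prod \<alpha> (x(i := y)) + monomial_sum l t (x(i := y))) has_real_derivative
      poly c t * (real (\<alpha> i) * power_prod (\<alpha>(i := \<alpha> i - 1)) x) + monomial_sum_deriv i l t x) (at (x i))"
    by (intro DERIV_add DERIV_cmult power_prod_DERIV Cons.IH)
  then show ?case
    by (simp only: p monomial_sum_Cons monomial_sum_deriv_def list.map sum_list.Cons prod.case)
qed

text \<open>The minimiser of a penalty functional \<open>s F + \<Sum> x\<^sub>i\<^sup>E\<close> with \<open>E > deg F\<close>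
  solves a system in which \<open>x\<^sub>i\<^sup>E\<^sup>-\<^sup>1\<close> is expressed by terms of lower degree.\<close>

lemma critical_point_relation:
  fixes l :: "(real poly \<times> ('i::finite \<Rightarrow> nat)) list"
  assumes deg: "\<And>c \<alpha>. (c,\<alpha>) \<in> set l \<Longrightarrow> sum \<alpha> UNIV \<le> E - 2" and E: "E \<ge> 2"
  obtains P :: "real poly poly poly" where "lead_coeff P = 1"
    "\<And>t s x. (\<And>j. s * monomial_sum_deriv j l t x + real E * x j ^ (E - 1) = 0) \<Longrightarrow>
      poly (map_poly (\<lambda>c. eval2 c t s) P) (x i) = 0"
proof -
  \<comment> \<open>All parameters, weights and critical points are treated at once, with
    coefficients in \<real>[t, s], so that one polynomial serves them all.\<close>
  define Z where "Z = {(t, s, x). \<forall>j. s * monomial_sum_deriv j l t x + real E * x j ^ (E - 1) = 0}"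
  define h where "h z c = eval2 c (fst z) (fst (snd z))" for z :: "real \<times> real \<times> ('i \<Rightarrow> real)" and c
  have hom: "comm_ring_hom (h z)" for z by unfold_locales (simp_all add: h_def)
  have red: "\<exists>k. (\<forall>(c,\<alpha>)\<in>set k. sum \<alpha> UNIV < E - 1) \<and>
      (\<forall>z\<in>Z. snd (snd z) j ^ (E - 1) = (\<Sum>(c,\<alpha>)\<leftarrow>k. h z c * power_prod \<alpha> (snd (snd z))))" for j
  proof -
    \<comment> \<open>The critical equation solved for the power E - 1 of coordinate j; the entry 0
      in front of the coefficient supplies the factor s.\<close>
    define k where "k = map (\<lambda>(c, \<alpha>). ([:0, Polynomial.smult (- real (\<alpha> j) / real E) c:], \<alpha>(j := \<alpha> j - 1))) l"
    have "sum \<beta> UNIV < E - 1" if "(d, \<beta>) \<in> set k" for d \<beta>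
    proof -
      obtain c \<alpha> where c: "(c, \<alpha>) \<in> set l" "\<beta> = \<alpha>(j := \<alpha> j - 1)"
        using \<open>(d, \<beta>) \<in> set k\<close> by (auto simp: k_def)
      have "sum \<beta> UNIV \<le> sum \<alpha> UNIV" unfolding c by (rule sum_mono) auto
      then show ?thesis using deg[OF c(1)] E by linarith
    qed
    moreover have "x j ^ (E - 1) = (\<Sum>(c,\<alpha>)\<leftarrow>k. h (t, s, x) c * power_prod \<alpha> x)" if "(t, s, x) \<in> Z" for t s x
    proof -
      have "s * monomial_sum_deriv j l t x + real E * x j ^ (E - 1) = 0" using that by (simp add: Z_def)
      then have "x j ^ (E - 1) = (- s / real E) * monomial_sum_deriv j l t x"
        using E by (simp add: field_simps)
      also have "\<dots> = (\<Sum>(c,\<alpha>)\<leftarrow>l. (- s / real E) * (poly c t * (real (\<alpha> j) * power_prod (\<alpha>(j := \<alpha> j - 1)) x)))"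
        unfolding monomial_sum_deriv_def by (simp add: sum_list_const_mult[symmetric] case_prod_unfold)
      also have "\<dots> = (\<Sum>(c,\<alpha>)\<leftarrow>k. h (t, s, x) c * power_prod \<alpha> x)"
        unfolding k_def by (simp add: comp_def case_prod_unfold h_def field_simps)
      finally show ?thesis .
    qed
    ultimately show ?thesis by (intro exI[of _ k]) auto
  qed
  have e: "snd (snd z) i = (\<Sum>(c,\<alpha>)\<leftarrow>[(1, \<lambda>j. if j = i then 1 else 0)]. h z c * power_prod \<alpha> (snd (snd z)))" for z
    by (simp add: h_def power_prod_single)
  obtain P where P: "lead_coeff P = 1" "\<And>z. z \<in> Z \<Longrightarrow> poly (map_poly (h z) P) (snd (snd z) i) = 0"
    using annihilating_poly_of_integral[of h "E - 1" Z "\<lambda>z. snd (snd z)" "\<lambda>z. snd (snd z) i", OF hom _ red e] E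
    by (metis One_nat_def Suc_1 Suc_le_lessD zero_less_diff)
  show thesis
  proof (rule that[OF P(1)])
    fix t s x assume "\<And>j. s * monomial_sum_deriv j l t x + real E * x j ^ (E - 1) = 0"
    then have "(t, s, x) \<in> Z" by (simp add: Z_def)
    from P(2)[OF this] show "poly (map_poly (\<lambda>c. eval2 c t s) P) (x i) = 0" by (simp add: h_def[abs_def])
  qed
qed

section \<open>Minimisers of the penalty functional and their limits\<close>

lemma sum_power_bound:
  fixes x :: "'i::finite \<Rightarrow> real"
  assumes "(\<Sum>i\<in>UNIV. x i ^ E) \<le> C" "even E" "E > 0"
  shows "\<bar>x i\<bar> \<le> 1 + C"
proof -
  have "x i ^ E \<le> (\<Sum>i\<in>UNIV. x i ^ E)" by (rule member_le_sum) (use assms in auto)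
  then have le: "\<bar>x i\<bar> ^ E \<le> C" using assms by (simp add: power_even_abs)
  show ?thesis
  proof (cases "\<bar>x i\<bar> \<le> 1")
    case True
    have "0 \<le> C" using le by (meson abs_ge_zero order_trans zero_le_power)
    then show ?thesis using True by linarith
  next
    case False
    then have "\<bar>x i\<bar> ^ 1 \<le> \<bar>x i\<bar> ^ E" using assms by (intro power_increasing) auto
    then show ?thesis using le by simp
  qed
qed

text \<open>Since \<open>F\<close> vanishes at \<open>x0\<close>, the functional has there a value
  \<open>C\<close> independent of \<open>s\<close>. Points with value at most \<open>C\<close> lie
  in a box, whose compactness provides the minimiser.\<close>

lemma penalty_minimum:
  fixes F :: "('i::finite \<Rightarrow> real) \<Rightarrow> real"
  assumes cont: "continuous_on UNIV (\<lambda>v::real^'i. F (\<lambda>i. v $ i))" and nonneg: "\<And>x. F x \<ge> 0"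
    and x0: "F x0 = 0" and E: "even E" "E > 0" and s: "s \<ge> 0"
  obtains x where "\<And>y. s * F x + (\<Sum>i\<in>UNIV. x i ^ E) \<le> s * F y + (\<Sum>i\<in>UNIV. y i ^ E)"
proof -
  define H where "H y = s * F y + (\<Sum>i\<in>UNIV. y i ^ E)" for y
  define C where "C = (\<Sum>i\<in>UNIV. x0 i ^ E)"
  define B where "B = {v::real^'i. \<forall>i. v $ i \<in> {- (1 + C)..1 + C}}"
  have "B = cbox (\<chi> i. - (1 + C)) (\<chi> i. 1 + C)" by (auto simp: B_def mem_box_cart)
  then have "compact B" by simp
  have bound: "(\<chi> i. y i) \<in> B" if "H y \<le> C" for y
  proof -
    have "0 \<le> s * F y" using s nonneg by simp
    then have "(\<Sum>i\<in>UNIV. y i ^ E) \<le> C" using that by (simp add: H_def)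
    then have b: "\<bar>y i\<bar> \<le> 1 + C" for i by (rule sum_power_bound[OF _ E])
    have "- (1 + C) \<le> y i" "y i \<le> 1 + C" for i using b[of i] by linarith+
    then show ?thesis unfolding B_def by simp
  qed
  have x0B: "(\<chi> i. x0 i) \<in> B" by (rule bound) (simp add: H_def C_def x0)
  have "continuous_on B (\<lambda>v. H (\<lambda>i. v $ i))"
    unfolding H_def by (intro continuous_intros continuous_on_subset[OF cont]) auto
  then obtain v where v: "v \<in> B" "\<And>w. w \<in> B \<Longrightarrow> H (\<lambda>i. v $ i) \<le> H (\<lambda>i. w $ i)"
    using continuous_attains_inf[OF \<open>compact B\<close>] x0B by blast
  have vC: "H (\<lambda>i. v $ i) \<le> C" using v(2)[OF x0B] by (simp add: H_def C_def x0)
  show thesis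
  proof (rule that[of "\<lambda>i. v $ i"])
    fix y
    have "H (\<lambda>i. v $ i) \<le> H y"
    proof (cases "H y \<le> C")
      case True
      then show ?thesis using v(2)[OF bound] by simp
    next
      case False
      then show ?thesis using vC by linarith
    qed
    then show "s * F (\<lambda>i. v $ i) + (\<Sum>i\<in>UNIV. (v $ i) ^ E) \<le> s * F y + (\<Sum>i\<in>UNIV. y i ^ E)"
      by (simp add: H_def)
  qed
qed

text \<open>The minimisers for the weights n = 0, 1, 2, ... stay in one box, so a subsequence
  converges; n F(t, X n) stays bounded, which makes the limit a zero of \<open>F\<close>. The
  minimisers are critical points, and their integral relations, uniform in t and n, pass to the
  limit.\<close>

lemma algebraic_zero:
  fixes F :: "real \<Rightarrow> ('i::finite \<Rightarrow> real) \<Rightarrow> real"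
  assumes F: "polyfun F" and nonneg: "\<And>t x. F t x \<ge> 0"
  obtains p :: "'i \<Rightarrow> real poly poly" where "\<And>i. p i \<noteq> 0"
    "\<And>t x0. F t x0 = 0 \<Longrightarrow> \<exists>x. F t x = 0 \<and> (\<forall>i. eval2 (p i) t (x i) = 0)"
proof -
  obtain l where l: "F = monomial_sum l" using polyfun_monomial_sum[OF F] by blast
  \<comment> \<open>Even for coercivity, and at least 2 above every degree, so that the powers E - 1
    dominate in the critical equations.\<close>
  define E where "E = 2 * (\<Sum>(c,\<alpha>)\<leftarrow>l. sum \<alpha> UNIV) + 2"
  have E: "even E" "E \<ge> 2" by (simp_all add: E_def)
  have deg: "sum \<alpha> UNIV \<le> E - 2" if "(c,\<alpha>) \<in> set l" for c \<alpha>
  proof -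
    have "sum \<alpha> UNIV \<le> (\<Sum>(c,\<alpha>)\<leftarrow>l. sum \<alpha> UNIV)"
      using that by (intro member_le_sum_list) force+
    then show ?thesis by (simp add: E_def)
  qed
  have "\<exists>P::real poly poly poly. lead_coeff P = 1 \<and>
    (\<forall>t s x. (\<forall>j. s * monomial_sum_deriv j l t x + real E * x j ^ (E - 1) = 0) \<longrightarrow>
      poly (map_poly (\<lambda>c. eval2 c t s) P) (x i) = 0)" for i
    by (rule critical_point_relation[where i = i, OF deg E(2)]) blast+
  then obtain P :: "'i \<Rightarrow> real poly poly poly" where P: "\<And>i. lead_coeff (P i) = 1"
    "\<And>i t s x. (\<forall>j. s * monomial_sum_deriv j l t x + real E * x j ^ (E - 1) = 0) \<Longrightarrow>
      poly (map_poly (\<lambda>c. eval2 c t s) (P i)) (x i) = 0" by metis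
  have "\<exists>q. q \<noteq> 0 \<and> (\<forall>t e e' s. filterlim s at_top sequentially \<longrightarrow> e' \<longlonglongrightarrow> e \<longrightarrow>
      (\<forall>n::nat. poly (map_poly (\<lambda>c. eval2 c t (s n)) (P i)) (e' n) = 0) \<longrightarrow> eval2 q t e = 0)" for i
    by (rule limit_relation[OF P(1)[of i]]) blast
  then obtain q where q0: "\<And>i. q i \<noteq> 0" and q: "\<And>i t e e' s. filterlim s at_top sequentially \<Longrightarrow>
      e' \<longlonglongrightarrow> e \<Longrightarrow> (\<forall>n::nat. poly (map_poly (\<lambda>c. eval2 c t (s n)) (P i)) (e' n) = 0) \<Longrightarrow>
      eval2 (q i) t e = 0"
    by metis
  show thesis
  proof (rule that[of q, OF q0])
    fix t x0 assume x0: "F t x0 = 0"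
    define C where "C = (\<Sum>i\<in>UNIV. x0 i ^ E)"
    have cont: "continuous_on UNIV (\<lambda>v::real^'i. F t (\<lambda>i. v $ i))"
      by (rule polyfun_continuous_on[OF F]) (intro continuous_intros)+
    have "\<exists>x. \<forall>y. real n * F t x + (\<Sum>i\<in>UNIV. x i ^ E) \<le> real n * F t y + (\<Sum>i\<in>UNIV. y i ^ E)" for n
      by (rule penalty_minimum[OF cont nonneg x0 E(1), of "real n"]) (use E in auto)
    then obtain X where X: "\<And>n y. real n * F t (X n) + (\<Sum>i\<in>UNIV. X n i ^ E)
        \<le> real n * F t y + (\<Sum>i\<in>UNIV. y i ^ E)" by metis
    have crit: "real n * monomial_sum_deriv j l t (X n) + real E * X n j ^ (E - 1) = 0" for n j
    proof (rule DERIV_local_min[of "\<lambda>y. real n * F t ((X n)(j := y)) + (\<Sum>i\<in>UNIV. ((X n)(j := y)) i ^ E)"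
          _ "X n j" 1])
      have "(\<Sum>i\<in>UNIV. ((X n)(j := y)) i ^ E) = y ^ E + (\<Sum>i\<in>UNIV-{j}. X n i ^ E)" for y
        by (subst sum.remove[of UNIV j]) auto
      moreover have "((\<lambda>y. real n * F t ((X n)(j := y)) + (y ^ E + (\<Sum>i\<in>UNIV-{j}. X n i ^ E)))
          has_real_derivative real n * monomial_sum_deriv j l t (X n) + real E * X n j ^ (E - 1)) (at (X n j))"
        unfolding l by (auto intro!: derivative_eq_intros monomial_sum_DERIV)
      ultimately show "((\<lambda>y. real n * F t ((X n)(j := y)) + (\<Sum>i\<in>UNIV. ((X n)(j := y)) i ^ E))
          has_real_derivative real n * monomial_sum_deriv j l t (X n) + real E * X n j ^ (E - 1)) (at (X n j))"
        by simp
      show "\<forall>y. \<bar>X n j - y\<bar> < 1 \<longrightarrow>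
          real n * F t ((X n)(j := X n j)) + (\<Sum>i\<in>UNIV. ((X n)(j := X n j)) i ^ E)
          \<le> real n * F t ((X n)(j := y)) + (\<Sum>i\<in>UNIV. ((X n)(j := y)) i ^ E)"
        unfolding fun_upd_triv using X by blast
    qed simp
    have le: "real n * F t (X n) + (\<Sum>i\<in>UNIV. X n i ^ E) \<le> C" for n using X[of n x0] x0 by (simp add: C_def)
    define B where "B = cbox (\<chi> i. - (1 + C)) (\<chi> i. 1 + C :: real ^ 'i)"
    have "(\<chi> i. X n i) \<in> B" for n
    proof -
      have "0 \<le> real n * F t (X n)" using nonneg by simp
      then have "(\<Sum>i\<in>UNIV. X n i ^ E) \<le> C" using le[of n] by linarith
      then have b: "\<bar>X n i\<bar> \<le> 1 + C" for i using E by (intro sum_power_bound) auto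
      have "- (1 + C) \<le> X n i" "X n i \<le> 1 + C" for i using b[of i] by linarith+
      then show ?thesis unfolding B_def by (simp add: mem_box_cart)
    qed
    moreover have "compact B" by (simp add: B_def)
    ultimately obtain v r where v: "strict_mono r" "((\<lambda>n. \<chi> i. X n i) \<circ> r) \<longlonglongrightarrow> v"
      unfolding compact_def by metis
    have lim: "(\<lambda>n. X (r n) i) \<longlonglongrightarrow> v $ i" for i
      using tendsto_vec_nth[OF v(2), of i] by (simp add: comp_def)
    have r: "filterlim (\<lambda>n. real (r n)) at_top sequentially"
      by (rule filterlim_compose[OF filterlim_real_sequentially filterlim_subseq[OF v(1)]])
    show "\<exists>x. F t x = 0 \<and> (\<forall>i. eval2 (q i) t (x i) = 0)"
    proof (intro exI conjI allI)
      show "eval2 (q i) t (v $ i) = 0" for i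
        by (rule q[OF r lim]) (use P(2) crit in blast)
      have "isCont (\<lambda>v::real^'i. F t (\<lambda>i. v $ i)) v" using cont by (simp add: continuous_on_eq_continuous_at)
      then have "(\<lambda>n. F t (X (r n))) \<longlonglongrightarrow> F t (\<lambda>i. v $ i)"
        using isCont_tendsto_compose[OF _ v(2)] by (fastforce simp: comp_def)
      \<comment> \<open>Comparison with \<open>x0\<close> bounds weight times \<open>F\<close> by
        \<open>C\<close>.\<close>
      moreover have "(\<lambda>n. F t (X (r n))) \<longlonglongrightarrow> 0"
      proof (rule tendsto_sandwich[where f = "\<lambda>_. 0" and h = "\<lambda>n. C * inverse (real (r n))"])
        show "\<forall>\<^sub>F n in sequentially. 0 \<le> F t (X (r n))" using nonneg by simp
        show "\<forall>\<^sub>F n in sequentially. F t (X (r n)) \<le> C * inverse (real (r n))"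
          using filterlim_at_top_dense[THEN iffD1, OF r, rule_format, of 0]
        proof eventually_elim
          case (elim n)
          have "0 \<le> (\<Sum>i\<in>UNIV. X (r n) i ^ E)" using E by (intro sum_nonneg) auto
          then have "real (r n) * F t (X (r n)) \<le> C" using le[of "r n"] by linarith
          then show ?case using elim by (simp add: field_simps)
        qed
        show "(\<lambda>n. C * inverse (real (r n))) \<longlonglongrightarrow> 0"
          using tendsto_mult_right_zero[OF tendsto_inverse_0_at_top[OF r]] .
      qed simp
      ultimately show "F t (\<lambda>i. v $ i) = 0" by (rule LIMSEQ_unique)
    qed
  qed
qed

section \<open>From solutions at a sequence of parameters to a curve\<close>

text \<open>One coordinate is treated after another; each step passes to a smaller set of
  parameters, still accumulating at 0, on which the new coordinate follows a single branch of simple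
  roots defined on a whole interval.\<close>

lemma simultaneous_branches:
  fixes Y :: "real \<Rightarrow> 'i \<Rightarrow> real" and p :: "'i \<Rightarrow> real poly poly"
  assumes p: "\<And>i. p i \<noteq> 0" and root: "\<And>t i. t \<in> T \<Longrightarrow> eval2 (p i) t (Y t i) = 0"
    and freq: "\<exists>\<^sub>F t in at_right 0. t \<in> T" and "finite I"
  shows "\<exists>T'\<subseteq>T. (\<exists>\<^sub>F t in at_right 0. t \<in> T') \<and> (\<forall>i\<in>I. \<exists>d b q. d > 0 \<and> degree q > 0 \<and>
    continuous_on {0<..<d} b \<and> (\<forall>t\<in>{0<..<d}. eval2 q t (b t) = 0 \<and> eval2 (pderiv q) t (b t) \<noteq> 0) \<and>
    (\<forall>t\<in>T'. Y t i = b t))"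
  using \<open>finite I\<close>
proof (induction I)
  case empty
  show ?case using freq by blast
next
  case (insert i I)
  then obtain S where S: "S \<subseteq> T" "\<exists>\<^sub>F t in at_right 0. t \<in> S" "\<forall>i\<in>I. \<exists>d b q. d > 0 \<and> degree q > 0 \<and>
      continuous_on {0<..<d} b \<and> (\<forall>t\<in>{0<..<d}. eval2 q t (b t) = 0 \<and> eval2 (pderiv q) t (b t) \<noteq> 0) \<and>
      (\<forall>t\<in>S. Y t i = b t)" by blast
  have "\<exists>\<^sub>F t in at_right 0. t \<in> S \<and> eval2 (p i) t (Y t i) = 0"
    using S(2) by (rule frequently_elim1) (use root S(1) in blast)
  then obtain q a c D where q: "\<exists>\<^sub>F t in at_right 0. t \<in> S \<and> eval2 q t (Y t i) = 0"
      "degree q > 0" "D \<noteq> 0" "a * q + c * pderiv q = [:D:]"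
    by (rule separable_relation[OF p])
  have "lead_coeff q * D \<noteq> 0" using q by auto
  then obtain d where d: "d > 0" "\<And>t. 0 < t \<Longrightarrow> t < d \<Longrightarrow> poly (lead_coeff q * D) t \<noteq> 0"
    using poly_nonzero_near_0 by blast
  have simple: "eval2 (pderiv q) t x \<noteq> 0" if t: "t \<in> {0<..<d}" and x: "eval2 q t x = 0" for t x
  proof
    assume "eval2 (pderiv q) t x = 0"
    then have "eval2 (a * q + c * pderiv q) t x = 0" using x by simp
    then show False using d(2)[of t] t unfolding q(4) by simp
  qed
  have lc: "poly (lead_coeff q) t \<noteq> 0" if "t \<in> {0<..<d}" for t using d(2)[of t] that by simp
  obtain b where b: "continuous_on {0<..<d} b" "\<forall>t\<in>{0<..<d}. eval2 q t (b t) = 0"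
      "\<exists>\<^sub>F t in at_right 0. t \<in> S \<and> Y t i = b t"
    by (rule root_branch[OF d(1) lc simple q(1)])
  define T' where "T' = {t\<in>S. Y t i = b t}"
  show ?case
  proof (intro exI[of _ T'] conjI ballI)
    show "T' \<subseteq> T" using S(1) by (auto simp: T'_def)
    show "\<exists>\<^sub>F t in at_right 0. t \<in> T'" using b(3) by (simp add: T'_def)
    fix j assume "j \<in> insert i I"
    then consider "j = i" | "j \<in> I" by blast
    then show "\<exists>d b q. d > 0 \<and> degree q > 0 \<and> continuous_on {0<..<d} b \<and>
        (\<forall>t\<in>{0<..<d}. eval2 q t (b t) = 0 \<and> eval2 (pderiv q) t (b t) \<noteq> 0) \<and> (\<forall>t\<in>T'. Y t j = b t)"
    proof cases
      case 1
      then show ?thesis using d(1) q(2) b simple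
        by (intro exI[of _ d] exI[of _ b] exI[of _ q]) (simp add: T'_def)
    next
      case 2
      then obtain e c r where "e > 0 \<and> degree r > 0 \<and> continuous_on {0<..<e} c \<and>
          (\<forall>t\<in>{0<..<e}. eval2 r t (c t) = 0 \<and> eval2 (pderiv r) t (c t) \<noteq> 0)"
        and "\<forall>t\<in>S. Y t j = c t" using S(3) by blast
      moreover from this(2) have "\<forall>t\<in>T'. Y t j = c t" by (simp add: T'_def)
      ultimately show ?thesis by (intro exI[of _ e] exI[of _ c] exI[of _ r]) blast
    qed
  qed
qed

text \<open>Continuous branches agree with solutions at parameters accumulating at 0; along them
  \<open>F\<close> has a constant sign near 0, hence vanishes there. Velocities are recorded as
  rational expressions so that the sign statement for polynomial functions also serves to estimate
  derivatives.\<close>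

theorem algebraic_curve_selection:
  fixes F :: "real \<Rightarrow> ('i::finite \<Rightarrow> real) \<Rightarrow> real"
  assumes F: "polyfun F" and nonneg: "\<And>t x. F t x \<ge> 0"
    and freq: "\<exists>\<^sub>F t in at_right 0. \<exists>x. F t x = 0"
  obtains d X X' where "d > 0" "\<And>t. t \<in> {0<..<d} \<Longrightarrow> F t (X t) = 0"
    "\<And>t i. t \<in> {0<..<d} \<Longrightarrow> ((\<lambda>t. X t i) has_real_derivative X' t i) (at t)"
    "\<And>i. \<exists>N M. polyfun N \<and> polyfun M \<and>
      (\<forall>t\<in>{0<..<d}. M t (X t) \<noteq> 0 \<and> X' t i = N t (X t) / M t (X t))"
    "\<And>G. polyfun G \<Longrightarrow> \<exists>e. 0 < e \<and> e \<le> d \<and> ((\<forall>t\<in>{0<..<e}. G t (X t) = 0) \<or>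
      (\<forall>t\<in>{0<..<e}. G t (X t) > 0) \<or> (\<forall>t\<in>{0<..<e}. G t (X t) < 0))"
proof -
  obtain p :: "'i \<Rightarrow> real poly poly" where p: "\<And>i. p i \<noteq> 0"
    "\<And>t x0. F t x0 = 0 \<Longrightarrow> \<exists>x. F t x = 0 \<and> (\<forall>i. eval2 (p i) t (x i) = 0)"
    using algebraic_zero[OF F nonneg] by blast
  define T where "T = {t. \<exists>x. F t x = 0}"
  have "\<forall>t\<in>T. \<exists>x. F t x = 0 \<and> (\<forall>i. eval2 (p i) t (x i) = 0)" using p(2) by (auto simp: T_def)
  then obtain Y where Y: "\<And>t. t \<in> T \<Longrightarrow> F t (Y t) = 0" "\<And>t i. t \<in> T \<Longrightarrow> eval2 (p i) t (Y t i) = 0"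
    by metis
  have "\<exists>\<^sub>F t in at_right 0. t \<in> T" using freq by (simp add: T_def)
  from simultaneous_branches[of p T Y, OF p(1) Y(2) this finite[of UNIV]]
  obtain S where S: "S \<subseteq> T" "\<exists>\<^sub>F t in at_right 0. t \<in> S"
    and "\<forall>i. \<exists>d b q. d > 0 \<and> degree q > 0 \<and> continuous_on {0<..<d} b \<and>
      (\<forall>t\<in>{0<..<d}. eval2 q t (b t) = 0 \<and> eval2 (pderiv q) t (b t) \<noteq> 0) \<and> (\<forall>t\<in>S. Y t i = b t)"
    by auto
  then obtain \<delta> b q where \<delta>: "\<And>i. \<delta> i > 0" and q: "\<And>i::'i. degree (q i) > 0"
    and b: "\<And>i. continuous_on {0<..<\<delta> i} (b i)"
    and root: "\<And>i t. t \<in> {0<..<\<delta> i} \<Longrightarrow> eval2 (q i) t (b i t) = 0"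
    and simple: "\<And>i t. t \<in> {0<..<\<delta> i} \<Longrightarrow> eval2 (pderiv (q i)) t (b i t) \<noteq> 0"
    and Yb: "\<And>i t. t \<in> S \<Longrightarrow> Y t i = b i t"
    by metis
  define X where "X t i = b i t" for t i
  define d where "d = Min (range \<delta>)"
  have d: "d > 0" unfolding d_def using \<delta> by (subst Min_gr_iff) auto
  have sub: "{0<..<d} \<subseteq> {0<..<\<delta> i}" for i
  proof -
    have "d \<le> \<delta> i" unfolding d_def by (rule Min_le) auto
    then show ?thesis by auto
  qed
  have contX: "continuous_on {0<..<d} (\<lambda>t. X t i)" for i
    unfolding X_def by (rule continuous_on_subset[OF b sub])
  have rootX: "eval2 (q i) t (X t i) = 0" if "t \<in> {0<..<d}" for t i
    using root[of t i] that sub[of i] unfolding X_def by blast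
  have simpleX: "eval2 (pderiv (q i)) t (X t i) \<noteq> 0" if "t \<in> {0<..<d}" for t i
    using simple[of t i] that sub[of i] unfolding X_def by blast
  have sign: "\<exists>e. 0 < e \<and> e \<le> d' \<and> ((\<forall>t\<in>{0<..<e}. G t (X t) = 0) \<or>
      (\<forall>t\<in>{0<..<e}. G t (X t) > 0) \<or> (\<forall>t\<in>{0<..<e}. G t (X t) < 0))"
    if G: "polyfun G" and d': "0 < d'" "d' \<le> d" for G d'
  proof -
    obtain r where r: "r \<noteq> 0" "\<And>t. t \<in> {0<..<d} \<Longrightarrow> eval2 r t (G t (X t)) = 0"
      using polyfun_algebraic[of q "{0<..<d}" X G, OF q rootX G] by blast
    have "continuous_on {0<..<d} (\<lambda>t. G t (X t))"
      by (rule polyfun_continuous_on[OF G contX continuous_on_id])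
    then have cont: "continuous_on {0<..<d'} (\<lambda>t. G t (X t))"
      by (rule continuous_on_subset) (use d' in auto)
    have zero: "eval2 r t (G t (X t)) = 0" if "t \<in> {0<..<d'}" for t
      using that d' by (intro r(2)) auto
    show ?thesis
    proof (rule algebraic_eventual_sign[OF r(1) d'(1) cont zero])
      fix e assume "0 < e" "e \<le> d'" "(\<forall>t\<in>{0<..<e}. G t (X t) = 0) \<or>
        (\<forall>t\<in>{0<..<e}. G t (X t) > 0) \<or> (\<forall>t\<in>{0<..<e}. G t (X t) < 0)"
      then show ?thesis by (intro exI[of _ e] conjI)
    qed
  qed
  obtain d' where d': "0 < d'" "d' \<le> d" and cases: "(\<forall>t\<in>{0<..<d'}. F t (X t) = 0) \<or>
      (\<forall>t\<in>{0<..<d'}. F t (X t) > 0) \<or> (\<forall>t\<in>{0<..<d'}. F t (X t) < 0)"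
    using sign[OF F d order_refl] by blast
  have "\<exists>\<^sub>F t in at_right 0. t \<in> S \<and> 0 < t \<and> t < d'"
    by (rule frequently_eventually_frequently[OF S(2) eventually_at_right_0_less[OF d'(1)]])
  \<comment> \<open>One parameter of \<open>S\<close> inside the interval of constant sign is enough
    to select the case in which \<open>F\<close> vanishes.\<close>
  then obtain t where t: "t \<in> S" "t \<in> {0<..<d'}" by (auto dest: frequently_ex)
  have "Y t = X t" using Yb[OF t(1)] by (simp add: X_def fun_eq_iff)
  then have "F t (X t) = 0" using Y(1)[of t] t(1) S(1) by auto
  then have zero: "\<forall>t\<in>{0<..<d'}. F t (X t) = 0" using cases t(2) by (metis less_irrefl)
  show thesis
  proof (rule that[OF d'(1), of X "\<lambda>t i. - eval2 (map_poly pderiv (q i)) t (X t i) / eval2 (pderiv (q i)) t (X t i)"])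
    show "F t (X t) = 0" if "t \<in> {0<..<d'}" for t using zero that by blast
  next
    fix t i assume "t \<in> {0<..<d'}"
    then have t: "t \<in> {0<..<d}" using d' by auto
    show "((\<lambda>t. X t i) has_real_derivative
        - eval2 (map_poly pderiv (q i)) t (X t i) / eval2 (pderiv (q i)) t (X t i)) (at t)"
    proof (rule implicit_DERIV)
      show "isCont (\<lambda>t. X t i) t"
        using contX[of i] t by (simp add: continuous_on_eq_continuous_at)
      have "\<forall>\<^sub>F t in nhds t. t \<in> {0<..<d}" using t by (intro eventually_nhds_in_open) auto
      then show "\<forall>\<^sub>F t in nhds t. eval2 (q i) t (X t i) = 0" by eventually_elim (rule rootX)
    qed (rule simpleX[OF t])
  next
    fix i
    show "\<exists>N M. polyfun N \<and> polyfun M \<and> (\<forall>t\<in>{0<..<d'}. M t (X t) \<noteq> 0 \<and>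
        - eval2 (map_poly pderiv (q i)) t (X t i) / eval2 (pderiv (q i)) t (X t i) = N t (X t) / M t (X t))"
      by (rule exI[of _ "\<lambda>t x. - eval2 (map_poly pderiv (q i)) t (x i)"],
          rule exI[of _ "\<lambda>t x. eval2 (pderiv (q i)) t (x i)"])
        (use simpleX d' in \<open>auto intro!: polyfun_minus polyfun_eval2 polyfun.coord polyfun.param\<close>)
  next
    fix G :: "real \<Rightarrow> ('i \<Rightarrow> real) \<Rightarrow> real" assume "polyfun G"
    then show "\<exists>e. 0 < e \<and> e \<le> d' \<and> ((\<forall>t\<in>{0<..<e}. G t (X t) = 0) \<or>
        (\<forall>t\<in>{0<..<e}. G t (X t) > 0) \<or> (\<forall>t\<in>{0<..<e}. G t (X t) < 0))"
      by (rule sign[OF _ d'])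
  qed
qed

section \<open>The argument of a complex polynomial\<close>

text \<open>The function b - 2 sqrt is nondecreasing, so between t/16 and t the values of
  \<open>b\<close> grow by at least (3/2) sqrt t, while the bound allows only (5/4) sqrt t.\<close>

lemma sqrt_growth_contradiction:
  fixes b :: "real \<Rightarrow> real"
  assumes "e > 0" and der: "\<And>t. t \<in> {0<..<e} \<Longrightarrow> (b has_real_derivative b' t) (at t)"
    and big: "\<And>t. t \<in> {0<..<e} \<Longrightarrow> b' t > 1 / sqrt t"
    and bound: "\<And>t. t \<in> {0<..<e} \<Longrightarrow> \<bar>b t\<bar> \<le> sqrt t"
  shows False
proof -
  define t where "t = e / 2"
  define s where "s = t / 16"
  have t: "0 < t" "t < e" and s: "0 < s" "s < t" using \<open>e > 0\<close> by (auto simp: t_def s_def)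
  have "b s - 2 * sqrt s \<le> b t - 2 * sqrt t"
  proof (rule DERIV_nonneg_imp_nondecreasing[where f = "\<lambda>t. b t - 2 * sqrt t"])
    fix x assume "s \<le> x" "x \<le> t"
    then have x: "x \<in> {0<..<e}" using s t by auto
    then have "((\<lambda>t. b t - 2 * sqrt t) has_real_derivative b' x - 2 * (inverse (sqrt x) / 2)) (at x)"
      by (intro DERIV_diff DERIV_cmult DERIV_real_sqrt der) auto
    moreover have "b' x - 2 * (inverse (sqrt x) / 2) \<ge> 0"
      using big[OF x] by (simp add: field_simps)
    ultimately show "\<exists>y. ((\<lambda>t. b t - 2 * sqrt t) has_real_derivative y) (at x) \<and> 0 \<le> y" by blast
  qed (use s in simp)
  moreover have "sqrt s = sqrt t / 4" by (simp add: s_def real_sqrt_divide)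
  moreover have "\<bar>b s\<bar> \<le> sqrt s" "\<bar>b t\<bar> \<le> sqrt t" using bound s t by auto
  moreover have "sqrt t > 0" using t by simp
  ultimately show False by linarith
qed

section \<open>Complex polynomial functions and their differentials\<close>

inductive cpolyfun :: "(complex ^ 'n \<Rightarrow> complex) \<Rightarrow> bool" where
  const: "cpolyfun (\<lambda>z. c)"
| coord: "cpolyfun (\<lambda>z. z $ j)"
| add: "cpolyfun f \<Longrightarrow> cpolyfun g \<Longrightarrow> cpolyfun (\<lambda>z. f z + g z)"
| mult: "cpolyfun f \<Longrightarrow> cpolyfun g \<Longrightarrow> cpolyfun (\<lambda>z. f z * g z)"

lemma cpolyfun_power: "cpolyfun f \<Longrightarrow> cpolyfun (\<lambda>z. f z ^ k)"
  by (induction k) (simp_all add: cpolyfun.const cpolyfun.mult)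

lemma cpolyfun_sum: "(\<And>a. a \<in> A \<Longrightarrow> cpolyfun (f a)) \<Longrightarrow> cpolyfun (\<lambda>z. \<Sum>a\<in>A. f a z)"
  by (induction A rule: infinite_finite_induct) (simp_all add: cpolyfun.const cpolyfun.add)

lemma cpolyfun_prod: "(\<And>a. a \<in> A \<Longrightarrow> cpolyfun (f a)) \<Longrightarrow> cpolyfun (\<lambda>z. \<Prod>a\<in>A. f a z)"
  by (induction A rule: infinite_finite_induct) (simp_all add: cpolyfun.const cpolyfun.mult)

text \<open>The coefficients of the complex linear differential are polynomial functions again,
  which makes criticality of the argument a polynomial condition.\<close>

lemma cpolyfun_deriv:
  fixes f :: "complex ^ 'n::finite \<Rightarrow> complex"
  assumes "cpolyfun f"
  shows "\<exists>D. (\<forall>j. cpolyfun (D j)) \<and> (\<forall>z. (f has_derivative (\<lambda>v. \<Sum>j\<in>UNIV. D j z * v $ j)) (at z))"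
  using assms
proof induction
  case (const c)
  show ?case by (rule exI[of _ "\<lambda>j z. 0"]) (simp add: cpolyfun.const)
next
  case (coord i)
  have "(\<Sum>j\<in>UNIV. (if j = i then 1 else 0) * v $ j) = v $ i" for v :: "complex ^ 'n"
  proof -
    have "(\<Sum>j\<in>UNIV. (if j = i then 1 else 0) * v $ j) = (\<Sum>j\<in>UNIV. if j = i then v $ j else 0)"
      by (rule sum.cong) auto
    then show ?thesis by simp
  qed
  moreover have "((\<lambda>z::complex ^ 'n. z $ i) has_derivative (\<lambda>v. v $ i)) (at z)" for z
    by (rule bounded_linear_imp_has_derivative[OF bounded_linear_vec_nth])
  ultimately show ?case
    by (intro exI[of _ "\<lambda>j z. if j = i then 1 else 0"]) (simp add: cpolyfun.const)
next
  case (add f g)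
  then obtain D E where D: "\<forall>j. cpolyfun (D j)" "\<forall>j. cpolyfun (E j)"
    "\<And>z. (f has_derivative (\<lambda>v. \<Sum>j\<in>UNIV. D j z * v $ j)) (at z)"
    "\<And>z. (g has_derivative (\<lambda>v. \<Sum>j\<in>UNIV. E j z * v $ j)) (at z)" by blast
  have "((\<lambda>z. f z + g z) has_derivative (\<lambda>v. \<Sum>j\<in>UNIV. (D j z + E j z) * v $ j)) (at z)" for z
    using has_derivative_add[OF D(3,4)] by (simp add: distrib_right sum.distrib)
  then show ?case using D(1,2)
    by (intro exI[of _ "\<lambda>j z. D j z + E j z"]) (simp add: cpolyfun.add)
next
  case (mult f g)
  then obtain D E where D: "\<forall>j. cpolyfun (D j)" "\<forall>j. cpolyfun (E j)"
    "\<And>z. (f has_derivative (\<lambda>v. \<Sum>j\<in>UNIV. D j z * v $ j)) (at z)"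
    "\<And>z. (g has_derivative (\<lambda>v. \<Sum>j\<in>UNIV. E j z * v $ j)) (at z)" by blast
  have "((\<lambda>z. f z * g z) has_derivative (\<lambda>v. \<Sum>j\<in>UNIV. (f z * E j z + D j z * g z) * v $ j)) (at z)" for z
    using has_derivative_mult[OF D(3,4)[of z]]
    by (rule has_derivative_eq_rhs)
      (simp add: fun_eq_iff algebra_simps sum.distrib sum_distrib_left)
  then show ?case using D(1,2) mult.hyps
    by (intro exI[of _ "\<lambda>j z. f z * E j z + D j z * g z"]) (simp add: cpolyfun.add cpolyfun.mult)
qed

text \<open>Real and imaginary parts of \<open>z\<^sub>j\<close> are the coordinates \<open>Some (j, True)\<close> and
  \<open>Some (j, False)\<close>; the coordinate \<open>None\<close> is an auxiliary variable for the inverse of \<open>\<bar>f\<bar>\<^sup>2\<close>.\<close>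

definition complex_vec :: "(('n \<times> bool) option \<Rightarrow> real) \<Rightarrow> complex ^ 'n" where
  "complex_vec x = (\<chi> j. Complex (x (Some (j, True))) (x (Some (j, False))))"

lemma polyfun_cpolyfun:
  fixes f :: "complex ^ 'n::finite \<Rightarrow> complex"
  assumes "cpolyfun f"
  shows "polyfun (\<lambda>t x. Re (f (complex_vec x))) \<and> polyfun (\<lambda>t x. Im (f (complex_vec x)))"
  using assms
  by induction
    (simp_all add: complex_vec_def polyfun.const polyfun.coord polyfun.add polyfun.mult polyfun_diff)

section \<open>Milnor's lemma for a single polynomial\<close>

text \<open>\<open>Im (cnj (f z) * Df z v)\<close> is |f|^2 times the derivative of arg f along v,
  so the claim is that arg f has no critical points on small spheres about the origin.\<close>

lemma argument_submersion:
  fixes f :: "complex ^ 'n::finite \<Rightarrow> complex"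
  assumes f: "cpolyfun f" and f0: "f 0 = 0" and Df: "\<And>z. (f has_derivative Df z) (at z)"
  shows "\<exists>\<delta>>0. \<forall>z. norm z \<le> \<delta> \<longrightarrow> f z \<noteq> 0 \<longrightarrow> (\<exists>v. z \<bullet> v = 0 \<and> Im (cnj (f z) * Df z v) \<noteq> 0)"
proof (rule ccontr)
  assume neg: "\<not> ?thesis"
  have bad: "\<exists>z. norm z \<le> \<delta> \<and> f z \<noteq> 0 \<and> (\<forall>v. z \<bullet> v = 0 \<longrightarrow> Im (cnj (f z) * Df z v) = 0)"
    if "\<delta> > 0" for \<delta> using neg that by blast
  obtain D where D: "\<And>j. cpolyfun (D j)"
    "\<And>z. (f has_derivative (\<lambda>v. \<Sum>j\<in>UNIV. D j z * v $ j)) (at z)"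
    using cpolyfun_deriv[OF f] by blast
  have Df_eq: "Df z v = (\<Sum>j\<in>UNIV. D j z * v $ j)" for z v
    using has_derivative_unique[OF Df D(2), of z] by (simp add: fun_eq_iff)
  define G where "G j z = cnj (f z) * D j z" for j z
  \<comment> \<open>Up to the factor |f|^2 these are the partial derivatives of arg f: a real
    direction gives Im G, an imaginary one Im (i G) = Re G.\<close>
  define T where "T a z = (if snd a then Im (G (fst a) z) else Re (G (fst a) z))" for a :: "'n \<times> bool" and z
  define u where "u z = (Re (f z))\<^sup>2 + (Im (f z))\<^sup>2" for z
  \<comment> \<open>A sum of squares encoding the system: the 2 by 2 minors make the gradient
    \<open>T\<close> parallel to z, the second term says |z|^2 = t, and the third, through the
    auxiliary variable, excludes zeros of f.\<close>
  define F where "F t x = (\<Sum>a\<in>UNIV. \<Sum>b\<in>UNIV.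
      (T a (complex_vec x) * x (Some b) - T b (complex_vec x) * x (Some a))\<^sup>2)
    + ((\<Sum>a\<in>UNIV. (x (Some a))\<^sup>2) - t)\<^sup>2 + (u (complex_vec x) * x None - 1)\<^sup>2" for t and x :: "('n \<times> bool) option \<Rightarrow> real"
  have pT: "polyfun (\<lambda>t x. T a (complex_vec x))" for a
    using polyfun_cpolyfun[OF f] polyfun_cpolyfun[OF D(1), of "fst a"]
    by (cases "snd a") (simp_all add: T_def G_def polyfun.mult polyfun.add polyfun_diff)
  have pu: "polyfun (\<lambda>t x. u (complex_vec x))"
    using polyfun_cpolyfun[OF f] unfolding u_def by (intro polyfun.add polyfun_power) auto
  have pF: "polyfun F" unfolding F_def
    by (intro polyfun.add polyfun_power polyfun_sum polyfun_diff polyfun.mult pT pu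
        polyfun.coord polyfun.const polyfun.param)
  have nonneg: "F t x \<ge> 0" for t x
    unfolding F_def by (intro add_nonneg_nonneg sum_nonneg zero_le_power2)
  have norm_sq: "(norm (complex_vec x))\<^sup>2 = (\<Sum>a\<in>UNIV. (x (Some a))\<^sup>2)"
    for x :: "('n \<times> bool) option \<Rightarrow> real"
  proof -
    have "(norm (complex_vec x))\<^sup>2 = (\<Sum>j\<in>UNIV. (x (Some (j, True)))\<^sup>2 + (x (Some (j, False)))\<^sup>2)"
      unfolding norm_vec_def L2_set_def complex_vec_def
      by (subst real_sqrt_pow2) (simp_all add: sum_nonneg cmod_power2)
    also have "\<dots> = (\<Sum>j\<in>UNIV. \<Sum>c\<in>UNIV. (x (Some (j, c)))\<^sup>2)" by (simp add: UNIV_bool add.commute)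
    also have "\<dots> = (\<Sum>a\<in>UNIV. (x (Some a))\<^sup>2)" by (simp add: sum.cartesian_product)
    finally show ?thesis .
  qed
  have "\<exists>\<^sub>F t in at_right 0. \<exists>x. F t x = 0"
    unfolding frequently_def eventually_at_right_field
  proof
    assume "\<exists>d>0. \<forall>t>0. t < d \<longrightarrow> \<not> (\<exists>x. F t x = 0)"
    then obtain d where d: "d > 0" "\<And>t x. 0 < t \<Longrightarrow> t < d \<Longrightarrow> F t x \<noteq> 0" by blast
    obtain z where z: "norm z \<le> sqrt (d / 2)" "f z \<noteq> 0"
        "\<And>v. z \<bullet> v = 0 \<Longrightarrow> Im (cnj (f z) * Df z v) = 0"
      using bad[of "sqrt (d / 2)"] d(1) by auto
    define x where "x a = (case a of None \<Rightarrow> 1 / u z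
      | Some (j, c) \<Rightarrow> if c then Re (z $ j) else Im (z $ j))" for a
    have zx: "complex_vec x = z" by (simp add: complex_vec_def x_def vec_eq_iff complex_eq_iff)
    define e :: "'n \<times> bool \<Rightarrow> complex ^ 'n" where "e a = axis (fst a) (if snd a then 1 else \<i>)" for a
    have inner_e: "z \<bullet> e a = x (Some a)" for a
      by (cases a) (auto simp: e_def x_def inner_axis inner_complex_def)
    have Df_e: "Im (cnj (f z) * Df z (e a)) = T a z" for a
    proof -
      have "Df z (e a) = (\<Sum>j\<in>UNIV. if j = fst a then D j z * (if snd a then 1 else \<i>) else 0)"
        unfolding Df_eq e_def by (rule sum.cong) (auto simp: axis_def)
      then have "Df z (e a) = D (fst a) z * (if snd a then 1 else \<i>)" by simp
      then show ?thesis by (simp add: T_def G_def)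
    qed
    have lin: "linear (Df z)" using Df has_derivative_linear by blast
    have TT: "T a z * x (Some b) - T b z * x (Some a) = 0" for a b
    proof -
      \<comment> \<open>This combination is orthogonal to z, so criticality makes the corresponding
        minor vanish.\<close>
      let ?v = "x (Some b) *\<^sub>R e a - x (Some a) *\<^sub>R e b"
      have "z \<bullet> ?v = 0" by (simp add: inner_diff_right inner_e)
      then have "Im (cnj (f z) * Df z ?v) = 0" by (rule z(3))
      moreover have "Im (cnj (f z) * Df z ?v)
          = x (Some b) * T a z - x (Some a) * T b z"
        unfolding Df_e[symmetric] by (simp add: linear_diff[OF lin] linear_scale[OF lin] algebra_simps)
      ultimately show ?thesis by (metis mult.commute)
    qed
    have "u z \<noteq> 0" using z(2) by (simp add: u_def complex_eq_iff sum_power2_eq_zero_iff)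
    then have "F ((norm z)\<^sup>2) x = 0"
      unfolding F_def norm_sq[of x, unfolded zx, symmetric] by (simp add: zx TT) (simp add: x_def)
    moreover have "0 < (norm z)\<^sup>2" using z(2) f0 by auto
    moreover have "(norm z)\<^sup>2 \<le> (sqrt (d / 2))\<^sup>2" using z(1) by (intro power_mono) auto
    then have "(norm z)\<^sup>2 < d" using d(1) by simp
    ultimately show False using d(2) by blast
  qed
  then obtain d X X' where d: "d > 0" and FX: "\<And>t. t \<in> {0<..<d} \<Longrightarrow> F t (X t) = 0"
    and derX: "\<And>t a. t \<in> {0<..<d} \<Longrightarrow> ((\<lambda>t. X t a) has_real_derivative X' t a) (at t)"
    and rat: "\<And>a. \<exists>N M. polyfun N \<and> polyfun M \<and>
      (\<forall>t\<in>{0<..<d}. M t (X t) \<noteq> 0 \<and> X' t a = N t (X t) / M t (X t))"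
    and sign: "\<And>G. polyfun G \<Longrightarrow> \<exists>e. 0 < e \<and> e \<le> d \<and> ((\<forall>t\<in>{0<..<e}. G t (X t) = 0) \<or>
      (\<forall>t\<in>{0<..<e}. G t (X t) > 0) \<or> (\<forall>t\<in>{0<..<e}. G t (X t) < 0))"
    using algebraic_curve_selection[OF pF nonneg] by blast
  define z where "z t = complex_vec (X t)" for t
  have TX: "T a (z t) * X t (Some b) = T b (z t) * X t (Some a)"
    and sq: "(\<Sum>a\<in>UNIV. (X t (Some a))\<^sup>2) = t" and u_pos: "u (z t) > 0"
    if t: "t \<in> {0<..<d}" for t a b
  proof -
    have nn: "0 \<le> (\<Sum>a\<in>UNIV. \<Sum>b\<in>UNIV. (T a (z t) * X t (Some b) - T b (z t) * X t (Some a))\<^sup>2)"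
      by (intro sum_nonneg zero_le_power2)
    have "(\<Sum>a\<in>UNIV. \<Sum>b\<in>UNIV. (T a (z t) * X t (Some b) - T b (z t) * X t (Some a))\<^sup>2) +
        ((\<Sum>a\<in>UNIV. (X t (Some a))\<^sup>2) - t)\<^sup>2 + (u (z t) * X t None - 1)\<^sup>2 = 0"
      using FX[OF t] by (simp add: F_def z_def)
    then have *: "(\<Sum>a\<in>UNIV. \<Sum>b\<in>UNIV. (T a (z t) * X t (Some b) - T b (z t) * X t (Some a))\<^sup>2) = 0"
        "((\<Sum>a\<in>UNIV. (X t (Some a))\<^sup>2) - t)\<^sup>2 = 0" "(u (z t) * X t None - 1)\<^sup>2 = 0"
      using nn by (smt (verit) zero_le_power2)+
    from *(1) have "(\<Sum>b\<in>UNIV. (T a (z t) * X t (Some b) - T b (z t) * X t (Some a))\<^sup>2) = 0"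
      using sum_nonneg_eq_0_iff[of UNIV "\<lambda>a. \<Sum>b\<in>UNIV. (T a (z t) * X t (Some b) - T b (z t) * X t (Some a))\<^sup>2"]
      by (metis (no_types, lifting) UNIV_I finite sum_nonneg zero_le_power2)
    then have "(T a (z t) * X t (Some b) - T b (z t) * X t (Some a))\<^sup>2 = 0"
      using sum_nonneg_eq_0_iff[of UNIV "\<lambda>b. (T a (z t) * X t (Some b) - T b (z t) * X t (Some a))\<^sup>2"]
      by (metis (no_types, lifting) UNIV_I finite zero_le_power2)
    then show "T a (z t) * X t (Some b) = T b (z t) * X t (Some a)" by simp
    show "(\<Sum>a\<in>UNIV. (X t (Some a))\<^sup>2) = t" using *(2) by simp
    have "u (z t) \<noteq> 0" using *(3) by auto
    moreover have "u (z t) \<ge> 0" by (simp add: u_def)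
    ultimately show "u (z t) > 0" by simp
  qed
  have X_bound: "\<bar>X t (Some a)\<bar> \<le> sqrt t" if t: "t \<in> {0<..<d}" for t a
  proof -
    have "(X t (Some a))\<^sup>2 \<le> (\<Sum>a\<in>UNIV. (X t (Some a))\<^sup>2)" by (rule member_le_sum) auto
    then show ?thesis using sq[OF t] real_le_rsqrt[of "\<bar>X t (Some a)\<bar>" t] by simp
  qed
  \<comment> \<open>With X' = N / M, the constant sign of N^2 t - M^2 decides between |X'| > 1 /
    sqrt t throughout and the desired bound; the sign of N M fixes that of X', and the first
    alternative then contradicts |X| \<le> sqrt t.\<close>
  have "\<exists>e. 0 < e \<and> e \<le> d \<and> (\<forall>t\<in>{0<..<e}. \<bar>X' t (Some a)\<bar> \<le> 1 / sqrt t)" for a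
  proof -
    obtain N M where N: "polyfun N" "polyfun M" and NM: "\<And>t. t \<in> {0<..<d} \<Longrightarrow>
        M t (X t) \<noteq> 0 \<and> X' t (Some a) = N t (X t) / M t (X t)"
      using rat[of "Some a"] by blast
    have "polyfun (\<lambda>t x. (N t x)\<^sup>2 * t - (M t x)\<^sup>2)" "polyfun (\<lambda>t x. N t x * M t x)"
      by (intro polyfun_diff polyfun.mult polyfun_power N polyfun.param)+
    from this[THEN sign] obtain e1 e2 where e1: "0 < e1" "e1 \<le> d"
        "(\<forall>t\<in>{0<..<e1}. (N t (X t))\<^sup>2 * t - (M t (X t))\<^sup>2 = 0) \<or>
         (\<forall>t\<in>{0<..<e1}. (N t (X t))\<^sup>2 * t - (M t (X t))\<^sup>2 > 0) \<or>
         (\<forall>t\<in>{0<..<e1}. (N t (X t))\<^sup>2 * t - (M t (X t))\<^sup>2 < 0)"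
      and e2: "0 < e2" "e2 \<le> d" "(\<forall>t\<in>{0<..<e2}. N t (X t) * M t (X t) = 0) \<or>
         (\<forall>t\<in>{0<..<e2}. N t (X t) * M t (X t) > 0) \<or> (\<forall>t\<in>{0<..<e2}. N t (X t) * M t (X t) < 0)"
      by blast
    define e where "e = min e1 e2"
    have e: "0 < e" "e \<le> d" using e1 e2 by (auto simp: e_def)
    have X'_sq: "(X' t (Some a))\<^sup>2 * t * (M t (X t))\<^sup>2 = (N t (X t))\<^sup>2 * t"
      and X'_sgn: "X' t (Some a) * (M t (X t))\<^sup>2 = N t (X t) * M t (X t)"
      and M_pos: "(M t (X t))\<^sup>2 > 0" if "t \<in> {0<..<e}" for t
    proof -
      have "M t (X t) \<noteq> 0 \<and> X' t (Some a) = N t (X t) / M t (X t)"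
        by (rule NM) (use that e in auto)
      then show "(X' t (Some a))\<^sup>2 * t * (M t (X t))\<^sup>2 = (N t (X t))\<^sup>2 * t"
        "X' t (Some a) * (M t (X t))\<^sup>2 = N t (X t) * M t (X t)"
        by (simp_all add: power_divide power2_eq_square)
      show "(M t (X t))\<^sup>2 > 0" using NM[of t] that e by (simp add: zero_less_power2)
    qed
    show ?thesis
    proof (cases "\<forall>t\<in>{0<..<e1}. (N t (X t))\<^sup>2 * t - (M t (X t))\<^sup>2 > 0")
      case True
      have large: "\<bar>X' t (Some a)\<bar> > 1 / sqrt t" if t: "t \<in> {0<..<e}" for t
      proof -
        have "(M t (X t))\<^sup>2 < (X' t (Some a))\<^sup>2 * t * (M t (X t))\<^sup>2"
          unfolding X'_sq[OF t] using True t by (auto simp: e_def)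
        then have "1 * (M t (X t))\<^sup>2 < ((X' t (Some a))\<^sup>2 * t) * (M t (X t))\<^sup>2" by simp
        then have "1 < (X' t (Some a))\<^sup>2 * t"
          using M_pos[OF t] by (simp only: mult_less_cancel_right_pos)
        then have "sqrt 1 < sqrt ((X' t (Some a))\<^sup>2 * t)" by (simp only: real_sqrt_less_iff)
        then have "1 < \<bar>X' t (Some a)\<bar> * sqrt t" by (simp add: real_sqrt_mult)
        then show ?thesis using t by (simp add: field_simps)
      qed
      have der: "((\<lambda>t. X t (Some a)) has_real_derivative X' t (Some a)) (at t)"
          "((\<lambda>t. - X t (Some a)) has_real_derivative - X' t (Some a)) (at t)" if "t \<in> {0<..<e}" for t
        using derX[of t "Some a"] that e by (auto intro: DERIV_minus)
      have bd: "\<bar>X t (Some a)\<bar> \<le> sqrt t" "\<bar>- X t (Some a)\<bar> \<le> sqrt t" if "t \<in> {0<..<e}" for t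
        using X_bound[of t a] that e by auto
      have "(\<forall>t\<in>{0<..<e2}. N t (X t) * M t (X t) \<ge> 0) \<or> (\<forall>t\<in>{0<..<e2}. N t (X t) * M t (X t) \<le> 0)"
        using e2(3) by (metis less_imp_le order_refl)
      then consider "\<forall>t\<in>{0<..<e2}. N t (X t) * M t (X t) \<ge> 0" | "\<forall>t\<in>{0<..<e2}. N t (X t) * M t (X t) \<le> 0"
        by blast
      then show ?thesis
      proof cases
        case 1
        have "X' t (Some a) > 1 / sqrt t" if t: "t \<in> {0<..<e}" for t
        proof -
          have "X' t (Some a) * (M t (X t))\<^sup>2 \<ge> 0" unfolding X'_sgn[OF t] using 1 t by (auto simp: e_def)
          then have "X' t (Some a) \<ge> 0" using M_pos[OF t] by (simp add: zero_le_mult_iff)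
          then show ?thesis using large[OF t] by simp
        qed
        from sqrt_growth_contradiction[OF e(1) der(1) this bd(1)] show ?thesis by simp
      next
        case 2
        have "- X' t (Some a) > 1 / sqrt t" if t: "t \<in> {0<..<e}" for t
        proof -
          have "X' t (Some a) * (M t (X t))\<^sup>2 \<le> 0" unfolding X'_sgn[OF t] using 2 t by (auto simp: e_def)
          then have "X' t (Some a) \<le> 0" using M_pos[OF t] by (simp add: mult_le_0_iff)
          then show ?thesis using large[OF t] by simp
        qed
        from sqrt_growth_contradiction[OF e(1) der(2) this bd(2)] show ?thesis by simp
      qed
    next
      case False
      then have le: "\<forall>t\<in>{0<..<e1}. (N t (X t))\<^sup>2 * t - (M t (X t))\<^sup>2 \<le> 0"
        using e1(3) by (metis less_imp_le order_refl)
      have "\<bar>X' t (Some a)\<bar> \<le> 1 / sqrt t" if t: "t \<in> {0<..<e}" for t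
      proof -
        have "(X' t (Some a))\<^sup>2 * t * (M t (X t))\<^sup>2 \<le> (M t (X t))\<^sup>2"
          unfolding X'_sq[OF t] using le[rule_format, of t] t by (simp add: e_def)
        then have "((X' t (Some a))\<^sup>2 * t) * (M t (X t))\<^sup>2 \<le> 1 * (M t (X t))\<^sup>2" by simp
        then have "(X' t (Some a))\<^sup>2 * t \<le> 1"
          using M_pos[OF t] by (simp only: mult_le_cancel_right_pos)
        then have "sqrt ((X' t (Some a))\<^sup>2 * t) \<le> sqrt 1" by (simp only: real_sqrt_le_iff)
        then have "\<bar>X' t (Some a)\<bar> * sqrt t \<le> 1" by (simp add: real_sqrt_mult)
        then show ?thesis using t by (simp add: field_simps)
      qed
      then show ?thesis using e by blast
    qed
  qed
  then obtain \<epsilon> where \<epsilon>: "\<And>a. 0 < \<epsilon> a" "\<And>a. \<epsilon> a \<le> d"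
    and X'_bound0: "\<And>a t. t \<in> {0<..<\<epsilon> a} \<Longrightarrow> \<bar>X' t (Some a)\<bar> \<le> 1 / sqrt t" by metis
  \<comment> \<open>The inner product of the gradient \<open>T\<close> with z; divided by t = |z|^2
    it is the multiplier \<lambda> of z in the gradient.\<close>
  define \<mu> where "\<mu> t = (\<Sum>b\<in>UNIV. T b (z t) * X t (Some b))" for t
  define lam where "lam t = \<mu> t / t" for t
  have "polyfun (\<lambda>t x. \<Sum>b\<in>UNIV. T b (complex_vec x) * x (Some b))"
    by (intro polyfun_sum polyfun.mult pT polyfun.coord)
  from sign[OF this] obtain e\<^sub>1 where e\<^sub>1: "0 < e\<^sub>1" "e\<^sub>1 \<le> d" "(\<forall>t\<in>{0<..<e\<^sub>1}. \<mu> t = 0) \<or>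
      (\<forall>t\<in>{0<..<e\<^sub>1}. \<mu> t > 0) \<or> (\<forall>t\<in>{0<..<e\<^sub>1}. \<mu> t < 0)"
    unfolding \<mu>_def z_def by blast
  obtain e\<^sub>2 where e\<^sub>2: "0 < e\<^sub>2" "e\<^sub>2 \<le> d" "(\<forall>t\<in>{0<..<e\<^sub>2}. Im (f (z t)) = 0) \<or>
      (\<forall>t\<in>{0<..<e\<^sub>2}. Im (f (z t)) > 0) \<or> (\<forall>t\<in>{0<..<e\<^sub>2}. Im (f (z t)) < 0)"
    using sign[OF polyfun_cpolyfun[OF f, THEN conjunct2]] unfolding z_def by blast
  define e where "e = min (Min (range \<epsilon>)) (min e\<^sub>1 e\<^sub>2)"
  have "0 < Min (range \<epsilon>)" using \<epsilon>(1) by (subst Min_gr_iff) auto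
  then have e: "0 < e" "e \<le> e\<^sub>1" "e \<le> e\<^sub>2" "e \<le> d" "e \<le> Min (range \<epsilon>)"
    using e\<^sub>1 e\<^sub>2 by (auto simp: e_def)
  have e_le: "e \<le> \<epsilon> a" for a using e(5) Min_le[of "range \<epsilon>" "\<epsilon> a"] by (meson finite finite_imageI order_trans rangeI)
  have X'_bound: "\<bar>X' t (Some a)\<bar> \<le> 1 / sqrt t" if "t \<in> {0<..<e}" for t a
    by (rule X'_bound0) (use that e_le[of a] in auto)
  have ed: "t \<in> {0<..<d}" if "t \<in> {0<..<e}" for t using that e by auto
  define h\<^sub>1 where "h\<^sub>1 t = Re (f (z t))" for t
  define h\<^sub>2 where "h\<^sub>2 t = Im (f (z t))" for t
  define U where "U t = (h\<^sub>1 t)\<^sup>2 + (h\<^sub>2 t)\<^sup>2" for t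
  define h' where "h' t = (\<Sum>j\<in>UNIV. D j (z t) * Complex (X' t (Some (j, True))) (X' t (Some (j, False))))" for t
  have U_pos: "U t > 0" if "t \<in> {0<..<e}" for t
    using u_pos[OF ed[OF that]] by (simp add: U_def h\<^sub>1_def h\<^sub>2_def u_def)
  have Tlam: "T a (z t) = lam t * X t (Some a)" if t: "t \<in> {0<..<e}" for t a
  proof -
    \<comment> \<open>Expanding t as the sum of the squared coordinates lets the vanishing minors
      exchange the indices.\<close>
    have "T a (z t) * t = (\<Sum>b\<in>UNIV. T a (z t) * X t (Some b) * X t (Some b))"
      by (subst sq[OF ed[OF t], symmetric]) (simp add: sum_distrib_left power2_eq_square mult.assoc)
    also have "\<dots> = (\<Sum>b\<in>UNIV. (T b (z t) * X t (Some b)) * X t (Some a))"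
      unfolding TX[OF ed[OF t], of a] by (simp add: mult_ac)
    also have "\<dots> = \<mu> t * X t (Some a)" by (simp add: \<mu>_def sum_distrib_right)
    finally show ?thesis using t by (simp add: lam_def field_simps)
  qed
  have dz: "(z has_vector_derivative (\<chi> j. Complex (X' t (Some (j, True))) (X' t (Some (j, False))))) (at t)"
    if t: "t \<in> {0<..<e}" for t
  unfolding has_vector_derivative_def
  proof (subst has_derivative_componentwise_within, intro ballI)
    fix i :: "complex ^ 'n" assume "i \<in> Basis"
    then obtain j b where i: "i = axis j b" "b = 1 \<or> b = \<i>"
      by (auto simp: Basis_vec_def Basis_complex_def)
    have "((\<lambda>t. X t a) has_derivative (*) (X' t a)) (at t)" for a
      using derX[OF ed[OF t]] by (simp add: has_field_derivative_def)
    from this[of "Some (j, True)"] this[of "Some (j, False)"] i(2)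
    show "((\<lambda>t. z t \<bullet> i) has_derivative (\<lambda>h. (h *\<^sub>R
        (\<chi> j. Complex (X' t (Some (j, True))) (X' t (Some (j, False))))) \<bullet> i)) (at t)"
      by (auto simp: i(1) inner_axis z_def complex_vec_def inner_complex_def mult.commute[of _ "X' t _"])
  qed
  have dh: "((\<lambda>t. f (z t)) has_vector_derivative h' t) (at t)" if t: "t \<in> {0<..<e}" for t
  proof -
    have "(f \<circ> z has_vector_derivative (\<Sum>j\<in>UNIV. D j (z t) *
        (\<chi> j. Complex (X' t (Some (j, True))) (X' t (Some (j, False)))) $ j)) (at t)"
      by (rule vector_derivative_diff_chain_within[OF dz[OF t] has_derivative_at_withinI[OF D(2)]])
    then show ?thesis by (simp add: comp_def h'_def)
  qed
  have dh1: "(h\<^sub>1 has_real_derivative Re (h' t)) (at t)" if t: "t \<in> {0<..<e}" for t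
    unfolding h\<^sub>1_def has_real_derivative_iff_has_vector_derivative
    by (rule bounded_linear.has_vector_derivative[OF bounded_linear_Re dh[OF t]])
  have dh2: "(h\<^sub>2 has_real_derivative Im (h' t)) (at t)" if t: "t \<in> {0<..<e}" for t
    unfolding h\<^sub>2_def has_real_derivative_iff_has_vector_derivative
    by (rule bounded_linear.has_vector_derivative[OF bounded_linear_Im dh[OF t]])
  \<comment> \<open>Re W is half the derivative of |f|^2 along the curve, and Im W is |f|^2 times
    the derivative of arg f.\<close>
  define W where "W t = cnj (f (z t)) * h' t" for t
  have ReW: "Re (W t) = h\<^sub>1 t * Re (h' t) + h\<^sub>2 t * Im (h' t)"
    and ImW: "Im (W t) = h\<^sub>1 t * Im (h' t) - h\<^sub>2 t * Re (h' t)" for t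
    by (simp_all add: W_def h\<^sub>1_def h\<^sub>2_def)
  \<comment> \<open>By criticality cnj(f) times the j-th partial derivative equals i \<lambda>
    cnj(z_j), so W is i \<lambda> times the sum of all cnj(z_j) z_j'.\<close>
  have W: "W t = (\<Sum>j\<in>UNIV. (Complex (lam t * X t (Some (j, False))) (lam t * X t (Some (j, True)))) *
      Complex (X' t (Some (j, True))) (X' t (Some (j, False))))" if t: "t \<in> {0<..<e}" for t
  proof -
    have "G j (z t) = Complex (lam t * X t (Some (j, False))) (lam t * X t (Some (j, True)))" for j
      using Tlam[OF t, of "(j, True)"] Tlam[OF t, of "(j, False)"] by (simp add: T_def complex_eq_iff)
    moreover have "W t = (\<Sum>j\<in>UNIV. G j (z t) * Complex (X' t (Some (j, True))) (X' t (Some (j, False))))"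
      by (simp add: W_def h'_def G_def sum_distrib_left mult.assoc)
    ultimately show ?thesis by simp
  qed
  \<comment> \<open>The real part of the sum of all cnj(z_j) z_j' is half the derivative of |z|^2 =
    t, that is 1/2.\<close>
  have ImW_lam: "Im (W t) = lam t / 2" if t: "t \<in> {0<..<e}" for t
  proof -
    have "((\<lambda>t. \<Sum>a\<in>UNIV. (X t (Some a))\<^sup>2) has_real_derivative
        (\<Sum>a\<in>UNIV. 2 * (X t (Some a) * X' t (Some a)))) (at t)"
      by (rule DERIV_sum) (use derX[OF ed[OF t]] in \<open>auto intro!: derivative_eq_intros\<close>)
    then have "((\<lambda>t. t) has_real_derivative (\<Sum>a\<in>UNIV. 2 * (X t (Some a) * X' t (Some a)))) (at t)"
      by (rule has_field_derivative_transform_within_open[of _ _ _ "{0<..<e}"]) (use t sq ed in auto)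
    then have "(\<Sum>a\<in>UNIV. 2 * (X t (Some a) * X' t (Some a))) = 1"
      using DERIV_ident DERIV_unique by blast
    then have half: "(\<Sum>a\<in>UNIV. X t (Some a) * X' t (Some a)) = 1 / 2"
      by (simp add: sum_distrib_left[symmetric])
    have "Im (W t) = lam t * (\<Sum>j\<in>UNIV. \<Sum>c\<in>UNIV. X t (Some (j, c)) * X' t (Some (j, c)))"
      unfolding W[OF t] by (simp add: UNIV_bool sum_distrib_left algebra_simps)
    then show ?thesis using half by (simp add: sum.cartesian_product)
  qed
  define n where "n = real CARD('n)"
  \<comment> \<open>The bounds sqrt t on the coordinates and 1 / sqrt t on the velocities cancel;
    each of the n complex coordinates contributes two products of size at most 1.\<close>
  have ReW_bound: "\<bar>Re (W t)\<bar> \<le> 2 * n * \<bar>lam t\<bar>" if t: "t \<in> {0<..<e}" for t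
  proof -
    have prod: "\<bar>X t (Some a) * X' t (Some b)\<bar> \<le> 1" for a b
    proof -
      have "\<bar>X t (Some a)\<bar> * \<bar>X' t (Some b)\<bar> \<le> sqrt t * (1 / sqrt t)"
        using X_bound[OF ed[OF t], of a] X'_bound[OF t, of b] t by (intro mult_mono) auto
      then show ?thesis using t by (simp add: abs_mult)
    qed
    have "Re (W t) = (\<Sum>j\<in>UNIV. lam t * (X t (Some (j, False)) * X' t (Some (j, True)) -
        X t (Some (j, True)) * X' t (Some (j, False))))"
      unfolding W[OF t] by (simp add: algebra_simps)
    also have "\<bar>\<dots>\<bar> \<le> (\<Sum>j\<in>(UNIV::'n set). \<bar>lam t\<bar> * 2)"
    proof (rule order_trans[OF sum_abs sum_mono])
      fix j
      have "\<bar>X t (Some (j, False)) * X' t (Some (j, True)) -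
          X t (Some (j, True)) * X' t (Some (j, False))\<bar> \<le> 2"
        using prod[of "(j, False)" "(j, True)"] prod[of "(j, True)" "(j, False)"] by linarith
      then show "\<bar>lam t * (X t (Some (j, False)) * X' t (Some (j, True)) -
          X t (Some (j, True)) * X' t (Some (j, False)))\<bar> \<le> \<bar>lam t\<bar> * 2"
        unfolding abs_mult by (intro mult_left_mono) auto
    qed
    finally show ?thesis by (simp add: n_def)
  qed
  have dU: "(U has_real_derivative 2 * Re (W t)) (at t)" if t: "t \<in> {0<..<e}" for t
    unfolding U_def ReW by (auto intro!: derivative_eq_intros dh1[OF t] dh2[OF t])
  \<comment> \<open>A positive lower bound for |f|^2 along the curve. If f is real there, then
    \<lambda> = 0 and |f|^2 is constant; otherwise the bounded argument controls log |f|.\<close>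
  have "\<exists>c>0. \<forall>t. 0 < t \<longrightarrow> t < e / 2 \<longrightarrow> c \<le> U t"
  proof (cases "\<forall>t\<in>{0<..<e\<^sub>2}. Im (f (z t)) = 0")
    case True
    have ReW0: "Re (W t) = 0" if t: "t \<in> {0<..<e}" for t
    proof -
      have "((\<lambda>s. 0) has_real_derivative Im (h' t)) (at t)"
        by (rule has_field_derivative_transform_within_open[OF dh2[OF t], of "{0<..<e}"])
          (use t True e in \<open>auto simp: h\<^sub>2_def\<close>)
      then have "Im (h' t) = 0" using DERIV_const DERIV_unique by blast
      moreover have "h\<^sub>2 t = 0" using True t e by (simp add: h\<^sub>2_def)
      ultimately have "Im (W t) = 0" by (simp add: ImW)
      then have "lam t = 0" using ImW_lam[OF t] by simp
      then show ?thesis using ReW_bound[OF t] by simp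
    qed
    have "U (e / 2) \<le> U t" if t: "0 < t" "t < e / 2" for t
    proof (rule DERIV_nonpos_imp_nonincreasing[where f = U])
      fix s assume "t \<le> s" "s \<le> e / 2"
      then have s: "s \<in> {0<..<e}" using t e(1) by auto
      show "\<exists>y. (U has_real_derivative y) (at s) \<and> y \<le> 0"
        using dU[OF s] ReW0[OF s] by auto
    qed (use t in simp)
    moreover have "U (e / 2) > 0" using e(1) by (intro U_pos) auto
    ultimately show ?thesis by blast
  next
    case False
    then have "\<forall>t\<in>{0<..<e\<^sub>2}. Im (f (z t)) \<noteq> 0" using e\<^sub>2(3) by (metis less_irrefl)
    then have h2: "h\<^sub>2 t \<noteq> 0" if "t \<in> {0<..<e}" for t
      using that e by (simp add: h\<^sub>2_def)
    \<comment> \<open>A continuous branch of arg f up to an additive constant, available since Im f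
      has no zeros on the interval, and bounded as an arctangent.\<close>
    define \<theta> where "\<theta> t = - arctan (h\<^sub>1 t / h\<^sub>2 t)" for t
    have d\<theta>: "(\<theta> has_real_derivative lam t / (2 * U t)) (at t)" if t: "t \<in> {0<..<e}" for t
    proof -
      have "(\<theta> has_real_derivative - (inverse (1 + (h\<^sub>1 t / h\<^sub>2 t)\<^sup>2) *
          ((Re (h' t) * h\<^sub>2 t - h\<^sub>1 t * Im (h' t)) / (h\<^sub>2 t * h\<^sub>2 t)))) (at t)"
        unfolding \<theta>_def
        by (intro DERIV_minus DERIV_chain2[OF DERIV_arctan] DERIV_divide dh1 dh2 t h2)
      moreover have sq: "1 + (h\<^sub>1 t / h\<^sub>2 t)\<^sup>2 = U t / (h\<^sub>2 t * h\<^sub>2 t)"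
        using h2[OF t] by (simp add: U_def field_simps power2_eq_square)
      have num: "Re (h' t) * h\<^sub>2 t - h\<^sub>1 t * Im (h' t) = - (lam t / 2)"
        using ImW[of t] ImW_lam[OF t] by (simp add: algebra_simps)
      have "- (inverse (1 + (h\<^sub>1 t / h\<^sub>2 t)\<^sup>2) *
          ((Re (h' t) * h\<^sub>2 t - h\<^sub>1 t * Im (h' t)) / (h\<^sub>2 t * h\<^sub>2 t))) = lam t / (2 * U t)"
        unfolding sq num using h2[OF t] U_pos[OF t] by (simp add: field_simps)
      ultimately show ?thesis by simp
    qed
    \<comment> \<open>The constant sign of \<lambda>, with 0 for a multiplier that vanishes
      identically.\<close>
    obtain \<sigma> where \<sigma>: "\<bar>\<sigma>\<bar> \<le> 1" "\<And>t. t \<in> {0<..<e} \<Longrightarrow> \<bar>lam t\<bar> = \<sigma> * lam t"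
    proof -
      have "\<exists>\<sigma>. \<bar>\<sigma>\<bar> \<le> 1 \<and> (\<forall>t\<in>{0<..<e}. \<bar>\<mu> t\<bar> = \<sigma> * \<mu> t)"
        using e\<^sub>1(3)
      proof (elim disjE)
        assume "\<forall>t\<in>{0<..<e\<^sub>1}. \<mu> t = 0" then show ?thesis using e by (intro exI[of _ 0]) auto
      next
        assume "\<forall>t\<in>{0<..<e\<^sub>1}. \<mu> t > 0"
        then have "\<forall>t\<in>{0<..<e}. \<mu> t > 0" using e by simp
        then show ?thesis by (intro exI[of _ 1]) (simp add: abs_of_pos)
      next
        assume "\<forall>t\<in>{0<..<e\<^sub>1}. \<mu> t < 0"
        then have "\<forall>t\<in>{0<..<e}. \<mu> t < 0" using e by simp
        then show ?thesis by (intro exI[of _ "-1"]) (simp add: abs_of_neg)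
      qed
      then obtain \<sigma> where "\<bar>\<sigma>\<bar> \<le> 1" "\<forall>t\<in>{0<..<e}. \<bar>\<mu> t\<bar> = \<sigma> * \<mu> t" by blast
      then show ?thesis by (intro that[of \<sigma>]) (auto simp: lam_def abs_divide)
    qed
    \<comment> \<open>Since (ln |f|^2)' is at most 4 n |\<lambda>| / |f|^2 = 8 n \<sigma> \<theta>',
      this function is nonincreasing; as |\<theta>| < 2, it bounds ln |f|^2 from below near
      0.\<close>
    define M where "M t = ln (U t) - 8 * n * \<sigma> * \<theta> t" for t
    have dM: "(M has_real_derivative 2 * Re (W t) / U t - 8 * n * \<sigma> * (lam t / (2 * U t))) (at t)"
      if t: "t \<in> {0<..<e}" for t
    proof -
      have "((\<lambda>t. ln (U t)) has_real_derivative inverse (U t) * (2 * Re (W t))) (at t)"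
        by (rule DERIV_chain2[OF DERIV_ln[OF U_pos[OF t]] dU[OF t]])
      then show ?thesis unfolding M_def
        by (intro DERIV_diff DERIV_cmult d\<theta>[OF t]) (simp add: field_simps)
    qed
    have "exp (M (e / 2) - 16 * n) \<le> U t" if t: "0 < t" "t < e / 2" for t
    proof -
      have "M (e / 2) \<le> M t"
      proof (rule DERIV_nonpos_imp_nonincreasing[where f = M])
        fix s assume "t \<le> s" "s \<le> e / 2"
        then have s: "s \<in> {0<..<e}" using t e(1) by auto
        have "2 * Re (W s) / U s - 8 * n * \<sigma> * (lam s / (2 * U s)) = (2 * Re (W s) - 4 * n * (\<sigma> * lam s)) / U s"
          using U_pos[OF s] by (simp add: field_simps)
        also have "\<dots> \<le> 0"
          using U_pos[OF s] ReW_bound[OF s] unfolding \<sigma>(2)[OF s, symmetric]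
          by (intro divide_nonpos_pos) auto
        finally show "\<exists>y. (M has_real_derivative y) (at s) \<and> y \<le> 0" using dM[OF s] by blast
      qed (use t in simp)
      moreover have "- (8 * n * \<sigma> * \<theta> t) \<le> 16 * n"
      proof -
        have "\<bar>\<theta> t\<bar> \<le> 2"
          using arctan_bounded[of "h\<^sub>1 t / h\<^sub>2 t"] pi_less_4 by (simp add: \<theta>_def abs_le_iff)
        then have "\<bar>\<sigma>\<bar> * \<bar>\<theta> t\<bar> \<le> 1 * 2" using \<sigma>(1) by (intro mult_mono) auto
        then have "- (\<sigma> * \<theta> t) \<le> 2" by (simp add: abs_mult[symmetric])
        then have "(8 * n) * - (\<sigma> * \<theta> t) \<le> (8 * n) * 2" by (intro mult_left_mono) (auto simp: n_def)
        then show ?thesis by (simp add: mult.assoc)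
      qed
      ultimately have "M (e / 2) - 16 * n \<le> ln (U t)" unfolding M_def by linarith
      then have "exp (M (e / 2) - 16 * n) \<le> exp (ln (U t))" by simp
      then show ?thesis using U_pos[of t] t by simp
    qed
    then show ?thesis by (intro exI[of _ "exp (M (e / 2) - 16 * n)"]) auto
  qed
  then obtain c where c: "c > 0" and U_ge: "\<And>t. 0 < t \<Longrightarrow> t < e / 2 \<Longrightarrow> c \<le> U t" by blast
  have "isCont f 0" using Df has_derivative_continuous by blast
  then obtain r where r: "r > 0" "\<And>w. norm w < r \<Longrightarrow> cmod (f w) < sqrt c"
    unfolding continuous_at_eps_delta using c f0 by (metis dist_0_norm dist_commute real_sqrt_gt_zero)
  \<comment> \<open>Small enough for the lower bound on |f|^2 and, as |z|^2 = t, for the continuity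
    of f at its zero 0.\<close>
  define t where "t = min (e / 4) (r\<^sup>2 / 2)"
  have t: "t \<in> {0<..<e}" "t < e / 2" "t < r\<^sup>2" using e(1) r(1) by (auto simp: t_def min_def)
  have "(norm (z t))\<^sup>2 < r\<^sup>2" using sq[OF ed[OF t(1)]] t(3) norm_sq[of "X t"] by (simp add: z_def)
  then have "norm (z t) < r" using r(1) by (simp add: power2_less_imp_less)
  then have "cmod (f (z t)) < sqrt c" by (rule r(2))
  then have "(cmod (f (z t)))\<^sup>2 < (sqrt c)\<^sup>2" by (intro power_strict_mono) auto
  then have "U t < c" using c by (simp add: U_def h\<^sub>1_def h\<^sub>2_def cmod_power2)
  then show False using U_ge[of t] t by auto
qed

section \<open>The product map\<close>

text \<open>Normalising forgets the radial part of \<open>h\<close>; what remains is rotation with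
  angular speed Im (cnj w * h) / |w|^2, the derivative of the argument.\<close>

lemma unit_complex_has_derivative:
  assumes "w \<noteq> 0"
  shows "((\<lambda>w. w / complex_of_real (cmod w)) has_derivative
    (\<lambda>h. \<i> * complex_of_real (Im (cnj w * h) / (cmod w)\<^sup>2) * (w / complex_of_real (cmod w)))) (at w)"
proof -
  define r where "r = complex_of_real (cmod w)"
  have r: "r \<noteq> 0" using assms by (simp add: r_def)
  have "((\<lambda>w. complex_of_real (cmod w)) has_derivative (\<lambda>h. complex_of_real (h \<bullet> sgn w))) (at w)"
    by (intro has_derivative_of_real has_derivative_norm assms)
  from has_derivative_divide'[OF has_derivative_ident this]
  have "((\<lambda>w. w / complex_of_real (cmod w)) has_derivative
      (\<lambda>h. (h * r - w * complex_of_real (h \<bullet> sgn w)) / (r * r))) (at w)"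
    using r by (simp add: r_def)
  moreover have "(h * r - w * complex_of_real (h \<bullet> sgn w)) / (r * r)
      = \<i> * complex_of_real (Im (cnj w * h) / (cmod w)\<^sup>2) * (w / r)" for h
  proof -
    have sgn: "complex_of_real (h \<bullet> sgn w) = complex_of_real (Re (cnj w * h)) / r"
      using assms by (simp add: r_def sgn_div_norm inner_complex_def field_simps)
    have "r * r = w * cnj w" by (simp add: r_def complex_norm_square[symmetric] power2_eq_square)
    then have "h * (r * r) = w * (cnj w * h)" by simp
    also have "cnj w * h = complex_of_real (Re (cnj w * h)) + \<i> * complex_of_real (Im (cnj w * h))"
      by (rule complex_eq)
    finally have "h * (r * r) - w * complex_of_real (Re (cnj w * h)) = \<i> * complex_of_real (Im (cnj w * h)) * w"
      by (simp add: algebra_simps)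
    then have "(h * (r * r) - w * complex_of_real (Re (cnj w * h))) / (r * r * r)
        = \<i> * complex_of_real (Im (cnj w * h)) * w / (r * r * r)" by simp
    moreover have "(h * r - w * complex_of_real (h \<bullet> sgn w)) / (r * r)
        = (h * (r * r) - w * complex_of_real (Re (cnj w * h))) / (r * r * r)"
      unfolding sgn using r by (simp add: field_simps)
    moreover have "\<i> * complex_of_real (Im (cnj w * h) / (cmod w)\<^sup>2) * (w / r)
        = \<i> * complex_of_real (Im (cnj w * h)) * w / (r * r * r)"
      by (simp add: r_def power2_eq_square)
    ultimately show ?thesis by metis
  qed
  ultimately show ?thesis by (simp add: r_def)
qed

text \<open>The line p + t v is projected radially back to the sphere: as v is orthogonal to p, |p +
  t v|^2 = \<epsilon>^2 + t^2 |v|^2 is stationary at t = 0, so normalising does not change the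
  velocity v.\<close>

lemma sphere_tangent:
  fixes p v :: "'a::euclidean_space"
  assumes "v \<bullet> p = 0" "norm p = \<epsilon>" "\<epsilon> > 0" and U: "open U" "p \<in> U"
  shows "v \<in> tangent_space (sphere 0 \<epsilon> \<inter> U) p"
proof -
  define q where "q t = \<epsilon>\<^sup>2 + t\<^sup>2 * (norm v)\<^sup>2" for t
  define \<gamma> where "\<gamma> t = (\<epsilon> / sqrt (q t)) *\<^sub>R (p + t *\<^sub>R v)" for t
  have q_pos: "q t > 0" for t using \<open>\<epsilon> > 0\<close> by (simp add: q_def add_pos_nonneg)
  have norm_sq: "(norm (p + t *\<^sub>R v))\<^sup>2 = q t" for t
  proof -
    have "(p + t *\<^sub>R v) \<bullet> (p + t *\<^sub>R v) = p \<bullet> p + t\<^sup>2 * (v \<bullet> v)"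
      using assms(1) by (simp add: inner_add_left inner_add_right inner_commute[of p v] power2_eq_square)
    then show ?thesis using assms(2) by (simp add: dot_square_norm q_def)
  qed
  then have norm_eq: "norm (p + t *\<^sub>R v) = sqrt (q t)" for t by (metis norm_ge_zero real_sqrt_unique)
  have \<gamma>0: "\<gamma> 0 = p" using \<open>\<epsilon> > 0\<close> by (simp add: \<gamma>_def q_def)
  have "(q has_real_derivative 0) (at 0)"
    unfolding q_def by (auto intro!: derivative_eq_intros)
  then have "((\<lambda>t. \<epsilon> / sqrt (q t)) has_real_derivative 0) (at 0)"
    using q_pos[of 0] by (auto intro!: derivative_eq_intros)
  moreover have "((\<lambda>t. p + t *\<^sub>R v) has_vector_derivative v) (at 0)"
    by (auto intro!: derivative_eq_intros)
  ultimately have "(\<gamma> has_vector_derivative (\<epsilon> / sqrt (q 0)) *\<^sub>R v + 0 *\<^sub>R (p + 0 *\<^sub>R v)) (at 0)"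
    unfolding \<gamma>_def by (rule has_vector_derivative_scaleR)
  then have d: "(\<gamma> has_vector_derivative v) (at 0)" using \<open>\<epsilon> > 0\<close> by (simp add: q_def)
  have sph: "\<gamma> t \<in> sphere 0 \<epsilon>" for t
    using \<open>\<epsilon> > 0\<close> q_pos[of t] by (simp add: \<gamma>_def norm_eq)
  have "isCont \<gamma> 0" using d by (rule has_vector_derivative_continuous)
  then have "\<forall>\<^sub>F t in at 0. \<gamma> t \<in> U"
    using topological_tendstoD[of \<gamma> "\<gamma> 0" "at 0" U] U \<gamma>0 by (simp add: isCont_def)
  then have "\<forall>\<^sub>F t in at 0. \<gamma> t \<in> sphere 0 \<epsilon> \<inter> U" by eventually_elim (use sph in blast)
  then show ?thesis unfolding tangent_space_def using \<gamma>0 d by blast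
qed

section \<open>Functions of part of the coordinates\<close>

text \<open>Invariance of a function under \<open>coord_proj J\<close> expresses that it depends
  only on the coordinates in \<open>J\<close>; functions of different variables thus share one
  ambient space.\<close>

definition coord_proj :: "'n set \<Rightarrow> complex ^ 'n \<Rightarrow> complex ^ 'n" where
  "coord_proj J z = (\<chi> j. if j \<in> J then z $ j else 0)"

lemma coord_proj_linear: "linear (coord_proj J)"
  by (rule linearI) (simp_all add: coord_proj_def vec_eq_iff)

lemma coord_proj_inner: "coord_proj J z \<bullet> w = z \<bullet> coord_proj J w"
  unfolding inner_vec_def coord_proj_def by (rule sum.cong) auto

lemma coord_proj_idem [simp]: "coord_proj J (coord_proj J z) = coord_proj J z"
  by (simp add: coord_proj_def vec_eq_iff)

lemma coord_proj_Compl [simp]: "coord_proj J (coord_proj (- J) z) = 0" "coord_proj (- J) (coord_proj J z) = 0"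
  by (simp_all add: coord_proj_def vec_eq_iff)

lemma norm_coord_proj_le: "norm (coord_proj J z) \<le> norm z"
  by (rule norm_le_componentwise_cart) (simp add: coord_proj_def)

lemma derivative_coord_proj:
  assumes Df: "\<And>z. (f has_derivative Df z) (at z)" and proj: "\<And>z. f (coord_proj J z) = f z"
  shows "Df z v = Df (coord_proj J z) (coord_proj J v)"
proof -
  have "(coord_proj J has_derivative coord_proj J) (at z)"
    by (rule linear_imp_has_derivative[OF coord_proj_linear])
  then have "(f \<circ> coord_proj J has_derivative Df (coord_proj J z) \<circ> coord_proj J) (at z)"
    using Df by (rule diff_chain_at)
  moreover have "f \<circ> coord_proj J = f" using proj by (simp add: fun_eq_iff)
  ultimately have "Df (coord_proj J z) \<circ> coord_proj J = Df z"
    using has_derivative_unique[OF _ Df[of z]] by simp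
  then show ?thesis by (metis comp_apply)
qed

text \<open>The submersion property is applied at the projected point, whose norm is not larger, so
  the same \<delta> serves. Self-adjointness of the projection turns tangency there into tangency at
  \<open>z\<close> of a vector in the \<open>J\<close> directions.\<close>

lemma argument_tangent_vector:
  fixes f :: "complex ^ 'n::finite \<Rightarrow> complex"
  assumes f: "cpolyfun f" and f0: "f 0 = 0" and Df: "\<And>z. (f has_derivative Df z) (at z)"
    and proj: "\<And>z. f (coord_proj J z) = f z"
  shows "\<exists>\<delta>>0. \<forall>z. norm z \<le> \<delta> \<longrightarrow> f z \<noteq> 0 \<longrightarrow>
    (\<exists>v. z \<bullet> coord_proj J v = 0 \<and> Im (cnj (f z) * Df z (coord_proj J v)) \<noteq> 0)"
proof -
  obtain \<delta> where \<delta>: "\<delta> > 0"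
    "\<And>z. norm z \<le> \<delta> \<Longrightarrow> f z \<noteq> 0 \<Longrightarrow> \<exists>v. z \<bullet> v = 0 \<and> Im (cnj (f z) * Df z v) \<noteq> 0"
    using argument_submersion[OF f f0 Df] by blast
  note Df_proj = derivative_coord_proj[of f Df J, OF Df proj]
  have "\<exists>v. z \<bullet> coord_proj J v = 0 \<and> Im (cnj (f z) * Df z (coord_proj J v)) \<noteq> 0"
    if z: "norm z \<le> \<delta>" "f z \<noteq> 0" for z
  proof -
    have "norm (coord_proj J z) \<le> \<delta>" "f (coord_proj J z) \<noteq> 0"
      using norm_coord_proj_le[of J z] z proj by auto
    then obtain v where v: "coord_proj J z \<bullet> v = 0" "Im (cnj (f z) * Df (coord_proj J z) v) \<noteq> 0"
      using \<delta>(2) proj by metis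
    moreover have "Df (coord_proj J z) v = Df z (coord_proj J v)"
      using Df_proj[of "coord_proj J z" v] Df_proj[of z "coord_proj J v"] by simp
    ultimately show ?thesis by (auto simp: coord_proj_inner)
  qed
  then show ?thesis using \<delta>(1) by blast
qed

lemma cpolyfun_has_derivative: "cpolyfun f \<Longrightarrow> \<exists>Df. \<forall>z. (f has_derivative Df z) (at z)"
  by (drule cpolyfun_deriv, elim exE conjE, rule exI)

lemma milnor_product_no_singular_point:
  fixes f g :: "complex ^ 'n::finite \<Rightarrow> complex"
  assumes f: "cpolyfun f" "f 0 = 0" "\<And>z. f (coord_proj J z) = f z"
    and g: "cpolyfun g" "g 0 = 0" "\<And>z. g (coord_proj (- J) z) = g z"
  shows "\<exists>\<epsilon>\<^sub>0>0. \<forall>\<epsilon>. 0 < \<epsilon> \<and> \<epsilon> \<le> \<epsilon>\<^sub>0 \<longrightarrow>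
    \<not> (\<exists>p. singular_point (sphere 0 \<epsilon> - K_link f g \<epsilon>) (milnor_product f g) p)"
proof -
  obtain Df where Df: "\<And>z. (f has_derivative Df z) (at z)"
    using cpolyfun_has_derivative[OF f(1)] by blast
  obtain Dg where Dg: "\<And>z. (g has_derivative Dg z) (at z)"
    using cpolyfun_has_derivative[OF g(1)] by blast
  have lin: "Df z 0 = 0" "Dg z 0 = 0" for z
    using Df Dg by (meson has_derivative_linear linear_0)+
  have Df0: "Df z (coord_proj (- J) v) = 0" for z v
    using derivative_coord_proj[of f Df J z "coord_proj (- J) v", OF Df f(3)] lin by simp
  have Dg0: "Dg z (coord_proj J v) = 0" for z v
    using derivative_coord_proj[of g Dg "- J" z "coord_proj J v", OF Dg g(3)] lin by simp
  obtain \<delta>\<^sub>1 where \<delta>\<^sub>1: "\<delta>\<^sub>1 > 0" "\<And>z. norm z \<le> \<delta>\<^sub>1 \<Longrightarrow> f z \<noteq> 0 \<Longrightarrow>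
      \<exists>v. z \<bullet> coord_proj J v = 0 \<and> Im (cnj (f z) * Df z (coord_proj J v)) \<noteq> 0"
    using argument_tangent_vector[OF f(1,2) Df f(3)] by blast
  obtain \<delta>\<^sub>2 where \<delta>\<^sub>2: "\<delta>\<^sub>2 > 0" "\<And>z. norm z \<le> \<delta>\<^sub>2 \<Longrightarrow> g z \<noteq> 0 \<Longrightarrow>
      \<exists>v. z \<bullet> coord_proj (- J) v = 0 \<and> Im (cnj (g z) * Dg z (coord_proj (- J) v)) \<noteq> 0"
    using argument_tangent_vector[OF g(1,2) Dg g(3)] by blast
  have "\<not> singular_point (sphere 0 \<epsilon> - K_link f g \<epsilon>) (milnor_product f g) p"
    if \<epsilon>: "0 < \<epsilon>" "\<epsilon> \<le> min \<delta>\<^sub>1 \<delta>\<^sub>2" for \<epsilon> p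
  proof
    define M where "M = sphere 0 \<epsilon> - K_link f g \<epsilon>"
    assume "singular_point (sphere 0 \<epsilon> - K_link f g \<epsilon>) (milnor_product f g) p"
    then have p: "p \<in> M" and rank: "diff_rank M (milnor_product f g) p < 2"
      by (simp_all add: singular_point_def M_def)
    define V where "V = {z. f z * g z \<noteq> 0}"
    have M_eq: "M = sphere 0 \<epsilon> \<inter> V" by (auto simp: M_def V_def K_link_def)
    have contf: "continuous_on UNIV f" and contg: "continuous_on UNIV g"
      using Df Dg by (meson continuous_at_imp_continuous_on has_derivative_continuous)+
    have "open V" unfolding V_def by (intro open_Collect_neq continuous_intros contf contg)
    have np: "norm p = \<epsilon>" and fp: "f p \<noteq> 0" and gp: "g p \<noteq> 0" and pV: "p \<in> V"
      using p by (auto simp: M_eq V_def)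
    obtain v\<^sub>1 where v\<^sub>1: "p \<bullet> coord_proj J v\<^sub>1 = 0" "Im (cnj (f p) * Df p (coord_proj J v\<^sub>1)) \<noteq> 0"
      using \<delta>\<^sub>1(2)[of p] np \<epsilon> fp by auto
    obtain v\<^sub>2 where v\<^sub>2: "p \<bullet> coord_proj (- J) v\<^sub>2 = 0" "Im (cnj (g p) * Dg p (coord_proj (- J) v\<^sub>2)) \<noteq> 0"
      using \<delta>\<^sub>2(2)[of p] np \<epsilon> gp by auto
    \<comment> \<open>The domain of the product map is open in the sphere, so every vector
      orthogonal to p is tangent to it.\<close>
    have tan: "v \<in> tangent_space M p" if "p \<bullet> v = 0" for v
      unfolding M_eq by (rule sphere_tangent) (use that np \<epsilon> \<open>open V\<close> pV in \<open>auto simp: inner_commute\<close>)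
    define A where "A v = \<i> * complex_of_real (Im (cnj (f p) * Df p v) / (cmod (f p))\<^sup>2) * (f p / complex_of_real (cmod (f p)))" for v
    define B where "B v = \<i> * complex_of_real (Im (cnj (g p) * Dg p v) / (cmod (g p))\<^sup>2) * (g p / complex_of_real (cmod (g p)))" for v
    have dA: "((\<lambda>z. f z / complex_of_real (cmod (f z))) has_derivative A) (at p)"
      using has_derivative_compose[OF Df unit_complex_has_derivative[OF fp]] by (simp add: A_def[abs_def])
    have dB: "((\<lambda>z. g z / complex_of_real (cmod (g z))) has_derivative B) (at p)"
      using has_derivative_compose[OF Dg unit_complex_has_derivative[OF gp]] by (simp add: B_def[abs_def])
    have "milnor_product f g = (\<lambda>z. (f z / complex_of_real (cmod (f z)), g z / complex_of_real (cmod (g z))))"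
      by (simp add: fun_eq_iff milnor_product_def)
    then have D: "(milnor_product f g has_derivative (\<lambda>v. (A v, B v))) (at p within M)"
      using has_derivative_at_withinI[OF has_derivative_Pair[OF dA dB]] by simp
    define S where "S = frechet_derivative (milnor_product f g) (at p within M) ` tangent_space M p"
    have mem: "(A v, B v) \<in> S" if "p \<bullet> v = 0" for v
      using frechet_derivative_tangent[OF D tan[OF that] p] tan[OF that] unfolding S_def by (metis imageI)
    define a where "a = A (coord_proj J v\<^sub>1)"
    define b where "b = B (coord_proj (- J) v\<^sub>2)"
    have nz: "\<i> * complex_of_real (x / (cmod w)\<^sup>2) * (w / complex_of_real (cmod w)) \<noteq> 0"
      if "x \<noteq> 0" "w \<noteq> 0" for x w using that by simp
    \<comment> \<open>A vector in the \<open>J\<close> directions turns the argument of f and leaves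
      g fixed to first order, so its image is (a, 0); symmetrically one obtains (0, b). These are
      independent over the reals.\<close>
    have a: "a \<noteq> 0" "(a, 0) \<in> S"
    proof -
      show "a \<noteq> 0" unfolding a_def A_def by (rule nz[OF v\<^sub>1(2) fp])
      have "B (coord_proj J v\<^sub>1) = 0" by (simp add: B_def Dg0)
      then show "(a, 0) \<in> S" using mem[OF v\<^sub>1(1)] by (simp add: a_def)
    qed
    have b: "b \<noteq> 0" "(0, b) \<in> S"
    proof -
      show "b \<noteq> 0" unfolding b_def B_def by (rule nz[OF v\<^sub>2(2) gp])
      have "A (coord_proj (- J) v\<^sub>2) = 0" by (simp add: A_def Df0)
      then show "(0, b) \<in> S" using mem[OF v\<^sub>2(1)] by (simp add: b_def)
    qed
    have "independent {(a, 0), (0, b)}"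
      by (rule pairwise_orthogonal_independent)
        (use a b in \<open>auto simp: pairwise_def orthogonal_def zero_prod_def\<close>)
    then have "card {(a, 0), (0, b)} \<le> dim S"
      using a b by (intro independent_card_le_dim) auto
    then have "2 \<le> dim S" using a(1) by simp
    then show False using rank by (simp add: diff_rank_def S_def)
  qed
  then show ?thesis using \<delta>\<^sub>1(1) \<delta>\<^sub>2(1) by (intro exI[of _ "min \<delta>\<^sub>1 \<delta>\<^sub>2"]) auto
qed

section \<open>From formal polynomials to functions\<close>

lemma cpolyfun_poly_fun: "cpolyfun (poly_fun \<sigma> p)"
  unfolding poly_fun_def eval_poly_def
  by (intro cpolyfun_sum cpolyfun.mult cpolyfun_prod cpolyfun_power cpolyfun.const cpolyfun.coord)

lemma poly_fun_coord_proj: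
  assumes "\<sigma> ` indets p \<subseteq> J"
  shows "poly_fun \<sigma> p (coord_proj J z) = poly_fun \<sigma> p z"
proof -
  have "coord_proj J z $ \<sigma> i = z $ \<sigma> i" if "t \<in> Poly_Mapping.keys p" "i \<in> Poly_Mapping.keys t" for t i
  proof -
    have "\<sigma> i \<in> J" using assms that by (auto simp: indets_def)
    then show ?thesis by (simp add: coord_proj_def)
  qed
  then show ?thesis unfolding poly_fun_def eval_poly_def by (simp cong: sum.cong prod.cong)
qed

theorem proposition3p3:
  fixes m n :: nat and \<sigma> :: "nat \<Rightarrow> 'n::finite" and f g :: cpoly
  assumes "1 \<le> m" and "m < n"
    and "bij_betw \<sigma> {1..n} (UNIV :: 'n set)"
    and "indets f \<subseteq> {1..m}" and "indets g \<subseteq> {m+1..n}"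
    and "eval_poly f (\<lambda>_. 0) = 0" and "eval_poly g (\<lambda>_. 0) = 0"
  shows "\<exists>\<epsilon>\<^sub>0>0. \<forall>\<epsilon>. 0 < \<epsilon> \<and> \<epsilon> \<le> \<epsilon>\<^sub>0 \<longrightarrow>
    \<not> (\<exists>p. singular_point (sphere 0 \<epsilon> - K_link (poly_fun \<sigma> f) (poly_fun \<sigma> g) \<epsilon>)
             (milnor_product (poly_fun \<sigma> f) (poly_fun \<sigma> g)) p)"
proof (rule milnor_product_no_singular_point)
  show "poly_fun \<sigma> f (coord_proj (\<sigma> ` {1..m}) z) = poly_fun \<sigma> f z" for z
    by (rule poly_fun_coord_proj) (use assms(4) in blast)
  have inj: "inj_on \<sigma> {1..n}" using assms(3) by (simp add: bij_betw_def)
  \<comment> \<open>Injectivity of the numbering keeps the variables of g outside the index set of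
    f, so g is a function of the complementary coordinates.\<close>
  have "\<sigma> ` {m+1..n} \<subseteq> - \<sigma> ` {1..m}"
  proof clarify
    fix i j assume "i \<in> {m+1..n}" "j \<in> {1..m}" "\<sigma> i = \<sigma> j"
    then have "i = j" using inj assms(2) by (auto dest: inj_onD)
    then show False using \<open>i \<in> {m+1..n}\<close> \<open>j \<in> {1..m}\<close> by simp
  qed
  then show "poly_fun \<sigma> g (coord_proj (- \<sigma> ` {1..m}) z) = poly_fun \<sigma> g z" for z
    by (intro poly_fun_coord_proj) (use assms(5) in blast)
qed (use assms(6,7) in \<open>simp_all add: cpolyfun_poly_fun poly_fun_def\<close>)

end
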